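(* Let $1\le p<+\infty$ and let $\sigma$ be a non-decreasing sigmoidal function satisfying: $\sigma(x)-1/2$ is odd; $\sigma\in C^2(\mathbb{R})$ is concave for $x\ge 0$; and $\sigma(x)=\mathcal{O}(|x|^{-1-\alpha})$ as $x\to-\infty$ for some $\alpha>p$. Let $I=[a_1,b_1]\times[a_2,b_2]$ be decomposed as $I=\bigcup_{i=0}^{q_1-1}\bigcup_{j=0}^{q_2-1}R_{ij}$, where $a_1=l_0<l_1<\dots<l_{q_1}=b_1$, $a_2=t_0<t_1<\dots<t_{q_2}=b_2$, and $R_{ij}$ is the product of the $i$-th interval $[l_i,l_{i+1})$ (closed on the right if $i=q_1-1$) and the $j$-th interval $[t_j,t_{j+1})$ (closed on the right if $j=q_2-1$). Let $f:I\to\mathbb{R}$ be a bounded function with $f\in C^1(R_{ij}^\circ)$ for all $i,j$, and suppose there are constants $M_f,\beta_f>0$ with $$M_f\ge\left|\frac{\partial f}{\partial x_m}(\mathtt{x})\right|^p\ge\beta_f>0,\qquad \mathtt{x}\in R_{ij}^\circ,\ m=1,2,\ i=0,\dots,q_1-1,\ j=0,\dots,q_2-1 .$$ Then, for $0<\nu<\alpha$ and $0<\theta<1$, and for $n\in\mathbb{N}^+$, $$\|F_n(f,\cdot)-f(\cdot)\|_p\ \le\ (2^{p-1}q_1q_2)^{1/p}\left(\left(\frac{M_f}{\beta_f}\right)^{1/p}\frac{K_1}{n}\|f\|_{1,p}+K_2\frac{\|f\|_\infty}{n^{\nu(1-\theta)/p}}+8^{1/p}\frac{\|f\|_\infty}{n^{\theta/p}}\right),$$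 where $K_2>0$ is a constant independent of $n$ and $f$, and $K_1>0$ is the constant, independent of $n$ and of the function, for which the following $C^1$-estimate holds: $\|F_n(g,\cdot)-g(\cdot)\|_p\le\frac{K_1}{n}\left(\frac{M_g}{\beta_g}\right)^{1/p}\|g\|_{1,p}$ for all $n\in\mathbb{N}^+$ and every $g\in C^1(I)$ for which there are constants $M_g,\beta_g>0$ with $M_g\ge|\partial g/\partial x_m(\mathtt{x})|^p\ge\beta_g$ for $\mathtt{x}\in I$, $m=1,2$.
   Context: A sigmoidal function is $\sigma:\mathbb{R}\to\mathbb{R}$ with $\lim_{x\to-\infty}\sigma(x)=0$ and $\lim_{x\to+\infty}\sigma(x)=1$. Functions on $I\subset\mathbb{R}^2$ and their partial derivatives are regarded as extended to $\mathbb{R}^2$ by periodicity in each variable. $A^\circ$ denotes the interior of $A$, and $\mathbb{N}^+$ the set of positive integers. Set $\phi_\sigma(x)=\frac12[\sigma(x+1)-\sigma(x-1)]$ for $x\in\mathbb{R}$, $\Psi_\sigma(\mathtt{x})=\phi_\sigma(x_1)\phi_\sigma(x_2)$ for $\mathtt{x}=(x_1,x_2)\in\mathbb{R}^2$, and $\mathcal{A}_n=\{\mathtt{k}\in\mathbb{Z}^2:\lceil na_i\rceil\le k_i\le\lfloor nb_i\rfloor,\ i=1,2\}$. The neural network operators are $$F_n(f,\mathtt{x})=\frac{\sum_{\mathtt{k}\in\mathcal{A}_n}f(\mathtt{k}/n)\,\Psi_\sigma(n\mathtt{x}-\mathtt{k})}{\sum_{\mathtt{k}\in\mathcal{A}_n}\Psi_\sigma(n\mathtt{x}-\mathtt{k})},\qquad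 \mathtt{x}\in I,\ \mathtt{k}/n=(k_1/n,k_2/n).$$ $\|\cdot\|_p$ is the $L^p(I)$-norm with respect to Lebesgue measure, $\|f\|_\infty=\sup_I|f|$, and $\|f\|_{1,p}=\|f\|_p+\sum_{m=1}^2\|\partial f/\partial x_m\|_p$, where for the piecewise $C^1$ function $f$ the partial derivatives are the classical ones, defined almost everywhere on $I$ (in the interiors $R_{ij}^\circ$). *)

theory Defs
  imports "HOL-Analysis.Analysis" "HOL-Library.Landau_Symbols"
begin

definition sigmoidal :: "(real \<Rightarrow> real) \<Rightarrow> bool" where
  "sigmoidal \<sigma> \<longleftrightarrow> (\<sigma> \<longlongrightarrow> 0) at_bot \<and> (\<sigma> \<longlongrightarrow> 1) at_top"

definition phi :: "(real \<Rightarrow> real) \<Rightarrow> real \<Rightarrow> real" where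
  "phi \<sigma> x = 1/2 * (\<sigma> (x + 1) - \<sigma> (x - 1))"

definition Psi :: "(real \<Rightarrow> real) \<Rightarrow> real \<times> real \<Rightarrow> real" where
  "Psi \<sigma> x = phi \<sigma> (fst x) * phi \<sigma> (snd x)"

definition grid_idx :: "real \<times> real \<Rightarrow> real \<times> real \<Rightarrow> nat \<Rightarrow> (int \<times> int) set" where
  "grid_idx a b n =
     {\<lceil>real n * fst a\<rceil>..\<lfloor>real n * fst b\<rfloor>} \<times> {\<lceil>real n * snd a\<rceil>..\<lfloor>real n * snd b\<rfloor>}"

definition real_pair :: "int \<times> int \<Rightarrow> real \<times> real" where
  "real_pair k = (real_of_int (fst k), real_of_int (snd k))"

text \<open>If n is so small that the index set is empty, the quotient below is 0 / 0 and
  the operator takes the value 0.\<close>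

definition NN_op ::
  "(real \<Rightarrow> real) \<Rightarrow> real \<times> real \<Rightarrow> real \<times> real \<Rightarrow> nat \<Rightarrow> (real \<times> real \<Rightarrow> real) \<Rightarrow> real \<times> real \<Rightarrow> real"
where
  "NN_op \<sigma> a b n f x =
     (\<Sum>k\<in>grid_idx a b n. f (real_pair k /\<^sub>R real n) * Psi \<sigma> (real n *\<^sub>R x - real_pair k)) /
     (\<Sum>k\<in>grid_idx a b n. Psi \<sigma> (real n *\<^sub>R x - real_pair k))"

text \<open>The partial derivative in the coordinate direction e, where Basis on the plane is
  {(1,0), (0,1)}. It is taken relative to the set S: this is the ordinary two-sided derivative at
  interior points of S and the one-sided derivative at the boundary points of a closed
  rectangle. Where the derivative does not exist the value is arbitrary.\<close>

definition partial_deriv ::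
  "(real \<times> real) set \<Rightarrow> (real \<times> real \<Rightarrow> real) \<Rightarrow> real \<times> real \<Rightarrow> real \<times> real \<Rightarrow> real" where
  "partial_deriv S f e x =
     vector_derivative (\<lambda>t. f (x + t *\<^sub>R e)) (at 0 within {t. x + t *\<^sub>R e \<in> S})"

definition C1_on :: "(real \<times> real) set \<Rightarrow> (real \<times> real \<Rightarrow> real) \<Rightarrow> bool" where
  "C1_on S f \<longleftrightarrow> (\<forall>e\<in>Basis.
     (\<forall>x\<in>S. (\<lambda>t. f (x + t *\<^sub>R e)) differentiable (at 0 within {t. x + t *\<^sub>R e \<in> S})) \<and>
     continuous_on S (partial_deriv S f e))"

text \<open>The Bochner integral makes this 0 when the p-th power of the absolute value is not
  integrable; it is used only for functions that are bounded a.e. and measurable on a bounded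
  rectangle. Completed Lebesgue measure is needed because a piecewise continuous
  function may be arbitrary on the (null) grid lines.\<close>

definition Lp_norm :: "real \<Rightarrow> (real \<times> real) set \<Rightarrow> (real \<times> real \<Rightarrow> real) \<Rightarrow> real" where
  "Lp_norm p S u = (\<integral>x. \<bar>u x\<bar> powr p \<partial>lebesgue_on S) powr (1 / p)"

definition sup_norm :: "(real \<times> real) set \<Rightarrow> (real \<times> real \<Rightarrow> real) \<Rightarrow> real" where
  "sup_norm S u = (SUP x\<in>S. \<bar>u x\<bar>)"

definition W1p_norm :: "real \<Rightarrow> (real \<times> real) set \<Rightarrow> (real \<times> real \<Rightarrow> real) \<Rightarrow> real" where
  "W1p_norm p S f = Lp_norm p S f + (\<Sum>e\<in>Basis. Lp_norm p S (partial_deriv S f e))"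

definition subdivision :: "real \<Rightarrow> real \<Rightarrow> nat \<Rightarrow> (nat \<Rightarrow> real) \<Rightarrow> bool" where
  "subdivision c d q l \<longleftrightarrow> l 0 = c \<and> l q = d \<and> (\<forall>i<q. l i < l (Suc i))"

definition piece :: "nat \<Rightarrow> (nat \<Rightarrow> real) \<Rightarrow> nat \<Rightarrow> real set" where
  "piece q l i = (if Suc i = q then {l i..l (Suc i)} else {l i..<l (Suc i)})"

definition cell ::
  "nat \<Rightarrow> nat \<Rightarrow> (nat \<Rightarrow> real) \<Rightarrow> (nat \<Rightarrow> real) \<Rightarrow> nat \<Rightarrow> nat \<Rightarrow> (real \<times> real) set" where
  "cell q1 q2 l t i j = piece q1 l i \<times> piece q2 t j"

text \<open>K is an admissible constant in the estimate for continuously differentiable functions on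
  the rectangle, uniformly in n and in the function.\<close>

definition C1_estimate ::
  "(real \<Rightarrow> real) \<Rightarrow> real \<times> real \<Rightarrow> real \<times> real \<Rightarrow> real \<Rightarrow> real \<Rightarrow> bool" where
  "C1_estimate \<sigma> a b p K \<longleftrightarrow> (\<forall>g M \<beta> n.
     C1_on (cbox a b) g \<and> 0 < M \<and> 0 < \<beta> \<and>
     (\<forall>x\<in>cbox a b. \<forall>e\<in>Basis.
        \<bar>partial_deriv (cbox a b) g e x\<bar> powr p \<le> M \<and>
        \<beta> \<le> \<bar>partial_deriv (cbox a b) g e x\<bar> powr p) \<and>
     0 < n \<longrightarrow>
     Lp_norm p (cbox a b) (\<lambda>x. NN_op \<sigma> a b n g x - g x)
       \<le> K / real n * (M / \<beta>) powr (1 / p) * W1p_norm p (cbox a b) g)"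

end

theory Submission
  imports Defs
begin

text \<open>
  Write \<open>B = \<parallel>f\<parallel>\<^sub>\<infinity>\<close>. The heart of the matter is a mean error estimate
  \<open>\<parallel>F\<^sub>n f - f\<parallel>\<^sub>1 \<le> C B q\<^sub>1 q\<^sub>2 / n\<close> in which the size of the gradient of \<open>f\<close> does not occur.
  On an open cell both partial derivatives of \<open>f\<close> are nonzero, so \<open>f\<close> is strictly monotone in each
  variable there. Hence on a coordinate line off the grid \<open>f\<close> is piecewise monotone and bounded by \<open>B\<close>, and its
  variation is at most a constant times \<open>B q\<^sub>1\<close> or \<open>B q\<^sub>2\<close>. For a function of one variable of
  variation \<open>V\<close>, the kernel-weighted distance between the values at the nodes \<open>k/n\<close> and the value
  at \<open>x\<close>, integrated over \<open>x\<close>, is at most \<open>V/n\<close> times a first moment of the kernel: after the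
  substitution \<open>u = n x - k\<close> the differences over all nodes telescope
  (\<open>monotone_sampling_integral\<close>). In the plane one goes from a node \<open>(i/n, j/n)\<close> to a point
  \<open>(u, v)\<close> through \<open>(u, j/n)\<close> and applies the one-dimensional estimate to both legs
  (\<open>piecewise_monotone_L1_majorant\<close>).

  Since \<open>\<bar>F\<^sub>n f - f\<bar> \<le> 2 B\<close>, the mean estimate gives
  \<open>\<parallel>F\<^sub>n f - f\<parallel>\<^sub>p\<^sup>p \<le> (2 B)\<^sup>p\<^sup>-\<^sup>1 \<parallel>F\<^sub>n f - f\<parallel>\<^sub>1\<close>, that is
  \<open>\<parallel>F\<^sub>n f - f\<parallel>\<^sub>p \<le> (2\<^sup>p\<^sup>-\<^sup>1 q\<^sub>1 q\<^sub>2)\<^sup>1\<^sup>/\<^sup>p B (C/n)\<^sup>1\<^sup>/\<^sup>p\<close>. Because \<open>\<theta> < 1\<close>, the quantity \<open>C/n\<close> falls below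
  \<open>8/n\<^sup>\<theta>\<close> for large \<open>n\<close>; up to that point \<open>n\<close> is bounded in terms of \<open>C\<close> and \<open>\<theta>\<close>, and the term with a large
  enough \<open>K\<^sub>2\<close> takes over (\<open>rate_comparison\<close>).

  That a constant \<open>K\<^sub>1\<close> exists is a separate argument. A function \<open>g\<close> of class \<open>C\<^sup>1\<close> is Lipschitz with
  constant \<open>M\<^sup>1\<^sup>/\<^sup>p\<close>, so the pointwise error of a weighted mean over the nodes is at most a constant times
  \<open>M\<^sup>1\<^sup>/\<^sup>p/n\<close>, by a discrete first moment of the kernel, and the lower bound \<open>\<beta>\<close> turns \<open>M\<^sup>1\<^sup>/\<^sup>p\<close> into
  \<open>(M/\<beta>)\<^sup>1\<^sup>/\<^sup>p\<close> times the norm of a partial derivative of \<open>g\<close> (\<open>C1_estimate_exists\<close>).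
\<close>

section \<open>Sums of increments of bounded monotone functions\<close>

lemma finite_int_symmetric_bound:
  fixes K :: "int set"
  assumes "finite K"
  obtains N :: nat where "K \<subseteq> {- int N..<int N}"
proof
  show "K \<subseteq> {- int (Suc (nat (Max (abs ` K))))..<int (Suc (nat (Max (abs ` K))))}"
  proof (rule subsetI)
    fix k assume "k \<in> K"
    hence "\<bar>k\<bar> \<le> Max (abs ` K)" using assms by (intro Max_ge) simp_all
    hence "- int (Suc (nat (Max (abs ` K)))) \<le> k \<and> k < int (Suc (nat (Max (abs ` K))))" by linarith
    thus "k \<in> {- int (Suc (nat (Max (abs ` K))))..<int (Suc (nat (Max (abs ` K))))}" by simp
  qed
qed

text \<open>Over an interval of integers the sum telescopes, and enlarging \<open>K\<close> to such an interval
  only adds nonnegative terms.\<close>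
lemma sum_increments_le:
  fixes H :: "int \<Rightarrow> real"
  assumes "mono H" "\<And>k. A \<le> H k" "\<And>k. H k \<le> B" "finite K"
  shows "(\<Sum>k\<in>K. H (k + 1) - H k) \<le> B - A"
proof -
  obtain N where N: "K \<subseteq> {- int N..<int N}"
    using finite_int_symmetric_bound[OF \<open>finite K\<close>] .
  have tele: "(\<Sum>k\<in>{- int N..<int N}. H (k + 1) - H k) = H (int N) - H (- int N)" for N
  proof (induction N)
    case (Suc N)
    have "{- int (Suc N)..<int (Suc N)} = insert (- int (Suc N)) (insert (int N) {- int N..<int N})"
      by auto
    thus ?case using Suc by (simp add: add.commute)
  qed simp
  have "(\<Sum>k\<in>K. H (k + 1) - H k) \<le> (\<Sum>k\<in>{- int N..<int N}. H (k + 1) - H k)"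
    using N monoD[OF \<open>mono H\<close>] by (intro sum_mono2) auto
  also have "\<dots> \<le> B - A"
    unfolding tele using assms(2)[of "- int N"] assms(3)[of "int N"] by linarith
  finally show ?thesis .
qed

lemma sum_shifts_le:
  fixes H :: "int \<Rightarrow> real"
  assumes "mono H" "\<And>k. A \<le> H k" "\<And>k. H k \<le> B" "finite K"
  shows "(\<Sum>k\<in>K. H (k + int N) - H k) \<le> real N * (B - A)"
proof (induction N)
  case (Suc N)
  have "(\<Sum>k\<in>K. H (k + int N + 1) - H (k + int N)) \<le> B - A"
    using sum_increments_le[of "\<lambda>k. H (k + int N)" A B K] assms
    by (simp add: mono_def add.assoc add.commute add.left_commute)
  moreover have "(\<Sum>k\<in>K. H (k + int (Suc N)) - H k) =
      (\<Sum>k\<in>K. H (k + int N + 1) - H (k + int N)) + (\<Sum>k\<in>K. H (k + int N) - H k)"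
    by (simp add: sum.distrib[symmetric] algebra_simps)
  ultimately show ?case using Suc.IH by (simp add: algebra_simps)
qed simp

text \<open>Rounding \<open>\<bar>u\<bar>\<close> up to an integer \<open>N\<close> bounds every difference by an increment over \<open>N\<close> unit
  steps. Each step telescopes over all sample points at once, so neither \<open>n\<close> nor the number of
  sample points enters the bound.\<close>
lemma sum_oscillation_le:
  fixes G :: "real \<Rightarrow> real"
  assumes G: "mono G" "\<And>x. A \<le> G x" "\<And>x. G x \<le> B" and K: "finite K" and n: "0 < n"
  shows "(\<Sum>k\<in>K. \<bar>G (of_int k / n) - G ((of_int k + u) / n)\<bar>) \<le> (\<bar>u\<bar> + 1) * (B - A)"
proof -
  define N where "N = nat \<lceil>\<bar>u\<bar>\<rceil>"
  have N: "\<bar>u\<bar> \<le> real N" "real N \<le> \<bar>u\<bar> + 1" unfolding N_def by linarith+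
  have AB: "A \<le> B" using G(2,3)[of 0] by linarith
  have le: "G (x / n) \<le> G (y / n)" if "x \<le> y" for x y
    using that n by (intro monoD[OF G(1)] divide_right_mono) auto
  have "(\<Sum>k\<in>K. \<bar>G (of_int k / n) - G ((of_int k + u) / n)\<bar>) \<le> real N * (B - A)"
  proof (cases "0 \<le> u")
    case True
    have "(\<Sum>k\<in>K. \<bar>G (of_int k / n) - G ((of_int k + u) / n)\<bar>) \<le>
        (\<Sum>k\<in>K. G (of_int (k + int N) / n) - G (of_int k / n))"
    proof (rule sum_mono)
      fix k
      show "\<bar>G (of_int k / n) - G ((of_int k + u) / n)\<bar> \<le> G (of_int (k + int N) / n) - G (of_int k / n)"
        using le[of "of_int k" "of_int k + u"] le[of "of_int k + u" "of_int (k + int N)"] True N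
        by simp
    qed
    also have "\<dots> \<le> real N * (B - A)"
      by (rule sum_shifts_le) (use G(2,3) K in \<open>auto simp: mono_def intro!: le\<close>)
    finally show ?thesis .
  next
    case False
    have "(\<Sum>k\<in>K. \<bar>G (of_int k / n) - G ((of_int k + u) / n)\<bar>) \<le>
        (\<Sum>k\<in>K. G (of_int (k + int N - int N) / n) - G (of_int (k - int N) / n))"
    proof (rule sum_mono)
      fix k
      show "\<bar>G (of_int k / n) - G ((of_int k + u) / n)\<bar> \<le>
          G (of_int (k + int N - int N) / n) - G (of_int (k - int N) / n)"
        using le[of "of_int k + u" "of_int k"] le[of "of_int (k - int N)" "of_int k + u"] False N
        by simp
    qed
    also have "\<dots> \<le> real N * (B - A)"
      by (rule sum_shifts_le[where H = "\<lambda>k. G (of_int (k - int N) / n)"])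
        (use G(2,3) K in \<open>auto simp: mono_def intro!: le\<close>)
    finally show ?thesis .
  qed
  also have "\<dots> \<le> (\<bar>u\<bar> + 1) * (B - A)" using N AB by (intro mult_right_mono) auto
  finally show ?thesis .
qed

section \<open>The kernel of a sigmoidal function\<close>

text \<open>An exponent above 1 makes the first moments of the kernel finite, as a sum over shifted
  integers and as an integral. The assumption \<open>reflect\<close> says that \<open>\<sigma> - 1/2\<close> is odd.\<close>
locale decaying_sigmoid =
  fixes \<sigma> :: "real \<Rightarrow> real" and \<alpha> :: real
  assumes mono: "mono \<sigma>"
    and sigmoidal: "sigmoidal \<sigma>"
    and reflect: "\<sigma> (- x) = 1 - \<sigma> x"
    and concave: "concave_on {0..} \<sigma>"
    and exponent: "1 < \<alpha>"
    and decay: "\<sigma> \<in> O[at_bot](\<lambda>x. \<bar>x\<bar> powr (- 1 - \<alpha>))"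
begin

lemma sigma_nonneg: "0 \<le> \<sigma> x"
proof (rule tendsto_upperbound)
  show "(\<sigma> \<longlongrightarrow> 0) at_bot" using sigmoidal by (simp add: sigmoidal_def)
  show "\<forall>\<^sub>F y in at_bot. \<sigma> y \<le> \<sigma> x"
    using eventually_le_at_bot[of x] by eventually_elim (use mono in \<open>auto dest: monoD\<close>)
qed simp

lemma sigma_le_1: "\<sigma> x \<le> 1"
  using sigma_nonneg[of "-x"] reflect[of x] by simp

lemma sigma_0: "\<sigma> 0 = 1/2"
  using reflect[of 0] by simp

text \<open>A concave function that does not rise on the unit interval never exceeds its value at 0
  afterwards, so it could not tend to 1.\<close>
lemma sigma_1: "1/2 < \<sigma> 1"
proof (rule ccontr)
  assume "\<not> 1/2 < \<sigma> 1"
  hence s1: "\<sigma> 1 \<le> 1/2" by simp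
  have "(\<sigma> \<longlongrightarrow> 1) at_top" using sigmoidal by (simp add: sigmoidal_def)
  hence "\<forall>\<^sub>F x in at_top. 1/2 < \<sigma> x" by (rule order_tendstoD) simp
  moreover have "\<forall>\<^sub>F x::real in at_top. 1 \<le> x" by (rule eventually_ge_at_top)
  ultimately have "\<forall>\<^sub>F x in at_top. 1/2 < \<sigma> x \<and> 1 \<le> x" by eventually_elim simp
  then obtain x where x: "1/2 < \<sigma> x" "1 \<le> x"
    using eventually_happens'[OF trivial_limit_at_top_linorder] by blast
  have "(1 - 1/x) * \<sigma> 0 + 1/x * \<sigma> x \<le> \<sigma> ((1 - 1/x) *\<^sub>R 0 + (1/x) *\<^sub>R x)"
    using x by (intro concave_onD[OF concave]) auto
  also have "(1 - 1/x) *\<^sub>R 0 + (1/x) *\<^sub>R x = 1" using x by simp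
  finally have "(1 - 1/x) * (1/2) + 1/x * \<sigma> x \<le> 1/2" using s1 unfolding sigma_0 by linarith
  hence "1/x * (\<sigma> x - 1/2) \<le> 0" unfolding left_diff_distrib right_diff_distrib by linarith
  moreover have "0 < 1/x * (\<sigma> x - 1/2)" using x by (intro mult_pos_pos) auto
  ultimately show False by simp
qed

lemma phi_nonneg: "0 \<le> phi \<sigma> x"
  using mono unfolding phi_def by (auto dest: monoD[of _ "x - 1" "x + 1"])

lemma phi_le_1: "phi \<sigma> x \<le> 1"
  using sigma_le_1[of "x+1"] sigma_nonneg[of "x-1"] unfolding phi_def by simp

lemma phi_even: "phi \<sigma> (- x) = phi \<sigma> x"
  using reflect[of "x - 1"] reflect[of "x + 1"] unfolding phi_def by simp

lemma phi_measurable [measurable]: "phi \<sigma> \<in> borel_measurable borel"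
proof -
  have [measurable]: "\<sigma> \<in> borel_measurable borel" by (rule borel_measurable_mono[OF mono])
  show ?thesis unfolding phi_def[abs_def] by measurable
qed

lemma Psi_nonneg: "0 \<le> Psi \<sigma> x"
  by (simp add: Psi_def phi_nonneg)

text \<open>A lower bound for the kernel on \<open>[-1, 1]\<close>. In each coordinate some index lies within
  distance 1 of \<open>n x\<close>, so \<open>kappa\<^sup>2\<close> bounds the denominator of the operator from below.\<close>
definition kappa :: real where "kappa = (\<sigma> 1 - 1/2) / 2"

lemma kappa_pos: "0 < kappa"
  using sigma_1 by (simp add: kappa_def)

lemma phi_ge_kappa:
  assumes "\<bar>u\<bar> \<le> 1" shows "kappa \<le> phi \<sigma> u"
proof -
  have *: "kappa \<le> phi \<sigma> u" if "0 \<le> u" "u \<le> 1" for u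
    using monoD[OF mono, of 1 "u+1"] monoD[OF mono, of "u-1" 0] that sigma_0
    by (simp add: phi_def kappa_def)
  show ?thesis
    using *[of u] *[of "-u"] assms phi_even[of u] by (cases "0 \<le> u") auto
qed

text \<open>The values of the kernel at \<open>u - k\<close> are the increments in \<open>k\<close> of the negated mean of
  \<open>\<sigma>\<close> at \<open>u - k + 1\<close> and \<open>u - k\<close>, a monotone function with values in \<open>[-1, 0]\<close>.\<close>
lemma sum_phi_le_1:
  assumes "finite K"
  shows "(\<Sum>k\<in>K. phi \<sigma> (u - of_int k)) \<le> 1"
proof -
  define H where "H k = - (\<sigma> (u - of_int k + 1) + \<sigma> (u - of_int k)) / 2" for k :: int
  have "(\<Sum>k\<in>K. phi \<sigma> (u - of_int k)) = (\<Sum>k\<in>K. H (k + 1) - H k)"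
    by (intro sum.cong) (auto simp: phi_def H_def field_simps)
  also have "\<dots> \<le> 0 - (- 1)"
  proof (rule sum_increments_le)
    show "mono H"
    proof (rule monoI)
      fix i j :: int assume "i \<le> j"
      hence "\<sigma> (u - of_int j + 1) \<le> \<sigma> (u - of_int i + 1)" "\<sigma> (u - of_int j) \<le> \<sigma> (u - of_int i)"
        by (auto intro!: monoD[OF mono])
      thus "H i \<le> H j" by (simp add: H_def)
    qed
    show "- 1 \<le> H k" "H k \<le> 0" for k
      using sigma_le_1[of "u - of_int k + 1"] sigma_le_1[of "u - of_int k"]
        sigma_nonneg[of "u - of_int k + 1"] sigma_nonneg[of "u - of_int k"]
      by (simp_all add: H_def)
  qed (use assms in simp)
  finally show ?thesis by simp
qed

text \<open>To the far left the kernel is at most \<open>\<sigma> (x + 1)\<close>, and \<open>\<bar>x + 1\<bar>\<close> is comparable to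
  \<open>1 + \<bar>x\<bar>\<close>; evenness transfers the bound to the right.\<close>
lemma phi_decay:
  obtains D where "0 < D" "\<And>x. phi \<sigma> x \<le> D * (1 + \<bar>x\<bar>) powr (- 1 - \<alpha>)"
proof -
  obtain C where C: "0 < C" "\<forall>\<^sub>F x in at_bot. norm (\<sigma> x) \<le> C * norm (\<bar>x\<bar> powr (- 1 - \<alpha>))"
    using landau_o.bigE[OF decay] by blast
  then obtain X where X: "\<And>x. x \<le> X \<Longrightarrow> \<sigma> x \<le> C * \<bar>x\<bar> powr (- 1 - \<alpha>)"
    by (auto simp: eventually_at_bot_linorder sigma_nonneg)
  \<comment> \<open>\<open>x \<le> - Y\<close> ensures both \<open>x + 1 \<le> X\<close> and \<open>\<bar>x + 1\<bar> \<ge> (1 + \<bar>x\<bar>) / 3\<close>.\<close>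
  define Y where "Y = \<bar>X\<bar> + 2"
  define D where "D = C * (1/3) powr (- 1 - \<alpha>) + (1 + Y) powr (1 + \<alpha>)"
  have D: "0 < D" unfolding D_def using C by (intro add_nonneg_pos) (auto simp: Y_def)
  have neg: "phi \<sigma> x \<le> D * (1 + \<bar>x\<bar>) powr (- 1 - \<alpha>)" if "x \<le> 0" for x
  proof (cases "x \<le> - Y")
    case True
    have "phi \<sigma> x \<le> \<sigma> (x + 1)"
      using sigma_nonneg[of "x+1"] sigma_nonneg[of "x-1"] by (simp add: phi_def)
    also have "\<dots> \<le> C * \<bar>x + 1\<bar> powr (- 1 - \<alpha>)"
      using True by (intro X) (auto simp: Y_def)
    also have "\<bar>x + 1\<bar> powr (- 1 - \<alpha>) \<le> (1/3 * (1 + \<bar>x\<bar>)) powr (- 1 - \<alpha>)"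
      by (rule powr_mono2') (use True exponent in \<open>auto simp: Y_def\<close>)
    also have "\<dots> = (1/3) powr (- 1 - \<alpha>) * (1 + \<bar>x\<bar>) powr (- 1 - \<alpha>)"
      by (rule powr_mult)
    finally have "phi \<sigma> x \<le> C * (1/3) powr (- 1 - \<alpha>) * (1 + \<bar>x\<bar>) powr (- 1 - \<alpha>)"
      using C by (simp add: mult_ac)
    also have "\<dots> \<le> D * (1 + \<bar>x\<bar>) powr (- 1 - \<alpha>)"
      by (rule mult_right_mono) (auto simp: D_def)
    finally show ?thesis .
  next
    case False
    have "1 = (1 + \<bar>x\<bar>) powr (1 + \<alpha>) * (1 + \<bar>x\<bar>) powr (- 1 - \<alpha>)"
      by (simp flip: powr_add)
    also have "\<dots> \<le> (1 + Y) powr (1 + \<alpha>) * (1 + \<bar>x\<bar>) powr (- 1 - \<alpha>)"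
      using False that exponent by (intro mult_right_mono powr_mono2) auto
    also have "\<dots> \<le> D * (1 + \<bar>x\<bar>) powr (- 1 - \<alpha>)"
      using C by (intro mult_right_mono) (auto simp: D_def)
    finally show ?thesis using phi_le_1[of x] by linarith
  qed
  have "phi \<sigma> x \<le> D * (1 + \<bar>x\<bar>) powr (- 1 - \<alpha>)" for x
    using neg[of x] neg[of "-x"] by (cases "x \<le> 0") (auto simp: phi_even)
  with D show ?thesis by (rule that)
qed

lemma phi_moment_decay:
  obtains D where "0 < D" "\<And>x. (\<bar>x\<bar> + 1) * phi \<sigma> x \<le> D * (1 + \<bar>x\<bar>) powr (- \<alpha>)"
proof -
  obtain D where D: "0 < D" "\<And>x. phi \<sigma> x \<le> D * (1 + \<bar>x\<bar>) powr (- 1 - \<alpha>)"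
    by (rule phi_decay) blast
  have "(\<bar>x\<bar> + 1) * phi \<sigma> x \<le> D * (1 + \<bar>x\<bar>) powr (- \<alpha>)" for x
  proof -
    have "(\<bar>x\<bar> + 1) * phi \<sigma> x \<le> (\<bar>x\<bar> + 1) * (D * (1 + \<bar>x\<bar>) powr (- 1 - \<alpha>))"
      by (intro mult_left_mono D) auto
    also have "\<dots> = D * ((1 + \<bar>x\<bar>) powr 1 * (1 + \<bar>x\<bar>) powr (- 1 - \<alpha>))" by simp
    also have "(1 + \<bar>x\<bar>) powr 1 * (1 + \<bar>x\<bar>) powr (- 1 - \<alpha>) = (1 + \<bar>x\<bar>) powr (- \<alpha>)"
      by (subst powr_add[symmetric]) simp
    finally show ?thesis .
  qed
  with D(1) show ?thesis by (rule that)
qed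

text \<open>On either side of \<open>u\<close> the distances \<open>\<bar>u - k\<bar>\<close> have pairwise different integer parts, so each
  half of the sum is dominated by one convergent series that does not depend on \<open>u\<close>.\<close>
lemma discrete_moment:
  obtains m where "0 < m"
    "\<And>u K. finite K \<Longrightarrow> (\<Sum>k\<in>K. \<bar>u - of_int k\<bar> * phi \<sigma> (u - of_int k)) \<le> m"
proof -
  obtain D where D: "0 < D" "\<And>x. (\<bar>x\<bar> + 1) * phi \<sigma> x \<le> D * (1 + \<bar>x\<bar>) powr (- \<alpha>)"
    by (rule phi_moment_decay) blast
  define s where "s j = D * (1 + real j) powr (- \<alpha>)" for j
  have s_nonneg: "0 \<le> s j" for j using D by (simp add: s_def)
  have "summable (\<lambda>j. real (Suc j) powr (- \<alpha>))"
    using exponent by (subst summable_Suc_iff) (simp add: summable_real_powr_iff)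
  hence sums: "summable s" unfolding s_def by (intro summable_mult) simp
  have half: "(\<Sum>k\<in>K. \<bar>u - of_int k\<bar> * phi \<sigma> (u - of_int k)) \<le> suminf s"
    if K: "finite K" and inj: "inj_on (\<lambda>k. nat \<lfloor>\<bar>u - of_int k\<bar>\<rfloor>) K" for u and K :: "int set"
  proof -
    let ?h = "\<lambda>k. nat \<lfloor>\<bar>u - of_int k\<bar>\<rfloor>"
    have "(\<Sum>k\<in>K. \<bar>u - of_int k\<bar> * phi \<sigma> (u - of_int k)) \<le> (\<Sum>k\<in>K. s (?h k))"
    proof (rule sum_mono)
      fix k assume "k \<in> K"
      let ?x = "u - of_int k"
      have "\<bar>?x\<bar> * phi \<sigma> ?x \<le> (\<bar>?x\<bar> + 1) * phi \<sigma> ?x"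
        by (intro mult_right_mono phi_nonneg) auto
      also have "\<dots> \<le> D * (1 + \<bar>?x\<bar>) powr (- \<alpha>)" by (rule D)
      also have "\<dots> \<le> s (?h k)"
        unfolding s_def using D exponent
        by (intro mult_left_mono powr_mono2') (auto simp: add_pos_nonneg)
      finally show "\<bar>?x\<bar> * phi \<sigma> ?x \<le> s (?h k)" .
    qed
    also have "\<dots> = sum s (?h ` K)" by (simp add: sum.reindex[OF inj])
    also have "\<dots> \<le> suminf s"
      by (rule sum_le_suminf) (use sums K s_nonneg in auto)
    finally show ?thesis .
  qed
  define m where "m = 2 * suminf s + 1"
  have "0 < m" using suminf_nonneg[OF sums s_nonneg] by (simp add: m_def)
  moreover have "(\<Sum>k\<in>K. \<bar>u - of_int k\<bar> * phi \<sigma> (u - of_int k)) \<le> m"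
    if K: "finite K" for u and K :: "int set"
  proof -
    define L where "L = {k\<in>K. of_int k \<le> u}"
    define R where "R = {k\<in>K. u < of_int k}"
    have "inj_on (\<lambda>k. nat \<lfloor>\<bar>u - of_int k\<bar>\<rfloor>) L"
    proof (rule inj_onI)
      fix x y assume xy: "x \<in> L" "y \<in> L" "nat \<lfloor>\<bar>u - of_int x\<bar>\<rfloor> = nat \<lfloor>\<bar>u - of_int y\<bar>\<rfloor>"
      moreover from xy have "x \<le> \<lfloor>u\<rfloor>" "y \<le> \<lfloor>u\<rfloor>" by (auto simp: L_def le_floor_iff)
      ultimately show "x = y" by (auto simp: L_def)
    qed
    moreover have "inj_on (\<lambda>k. nat \<lfloor>\<bar>u - of_int k\<bar>\<rfloor>) R"
    proof (rule inj_onI)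
      fix x y assume xy: "x \<in> R" "y \<in> R" "nat \<lfloor>\<bar>u - of_int x\<bar>\<rfloor> = nat \<lfloor>\<bar>u - of_int y\<bar>\<rfloor>"
      hence "\<lfloor>of_int x - u\<rfloor> = \<lfloor>of_int y - u\<rfloor>"
        by (simp add: R_def eq_nat_nat_iff)
      thus "x = y" by linarith
    qed
    ultimately have "(\<Sum>k\<in>L. \<bar>u - of_int k\<bar> * phi \<sigma> (u - of_int k)) +
        (\<Sum>k\<in>R. \<bar>u - of_int k\<bar> * phi \<sigma> (u - of_int k)) \<le> suminf s + suminf s"
      using K by (intro add_mono half) (auto simp: L_def R_def)
    moreover have "K = L \<union> R" "L \<inter> R = {}" "finite L" "finite R"
      using K by (auto simp: L_def R_def)
    ultimately show ?thesis by (simp add: sum.union_disjoint m_def)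
  qed
  ultimately show ?thesis by (rule that)
qed

lemma integral_moment:
  obtains W where "0 < W" "(\<integral>\<^sup>+u. ennreal ((\<bar>u\<bar> + 1) * phi \<sigma> u) \<partial>lborel) \<le> ennreal W"
proof -
  obtain D where D: "0 < D" "\<And>x. (\<bar>x\<bar> + 1) * phi \<sigma> x \<le> D * (1 + \<bar>x\<bar>) powr (- \<alpha>)"
    by (rule phi_moment_decay) blast
  let ?F = "\<lambda>x::real. D * (1 + x) powr (1 - \<alpha>) / (1 - \<alpha>)"
  let ?f = "\<lambda>x::real. ennreal (D * (1 + \<bar>x\<bar>) powr (- \<alpha>)) * indicator {0..} x"
  have lim: "(?F \<longlongrightarrow> 0) at_top"
  proof -
    have "((\<lambda>x::real. (1 + x) powr (1 - \<alpha>)) \<longlongrightarrow> 0) at_top"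
      using exponent by (intro tendsto_neg_powr filterlim_tendsto_add_at_top[OF tendsto_const] filterlim_ident) auto
    from tendsto_mult[OF tendsto_const[of "D / (1 - \<alpha>)"] this] show ?thesis by simp
  qed
  have "(\<integral>\<^sup>+x. ?f x \<partial>lborel) = (\<integral>\<^sup>+x. ennreal (D * (1 + x) powr (- \<alpha>)) * indicator {0..} x \<partial>lborel)"
    by (intro nn_integral_cong) (auto simp: indicator_def)
  also have "\<dots> = ennreal (0 - ?F 0)"
  proof (rule nn_integral_FTC_atLeast[OF _ _ _ lim])
    show "(?F has_real_derivative D * (1 + x) powr (- \<alpha>)) (at x)" if "0 \<le> x" for x
      using that exponent by (auto intro!: derivative_eq_intros)
  qed (use D in auto)
  finally have half: "(\<integral>\<^sup>+x. ?f x \<partial>lborel) = ennreal (D / (\<alpha> - 1))"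
    using exponent minus_divide_right[of D "1 - \<alpha>"] by simp
  have "(\<integral>\<^sup>+x. ennreal ((\<bar>x\<bar> + 1) * phi \<sigma> x) \<partial>lborel) \<le> (\<integral>\<^sup>+x. ?f x + ?f (0 + (-1) * x) \<partial>lborel)"
  proof (rule nn_integral_mono)
    fix x :: real
    have "ennreal ((\<bar>x\<bar> + 1) * phi \<sigma> x) \<le> ennreal (D * (1 + \<bar>x\<bar>) powr (- \<alpha>))"
      by (intro ennreal_leI D)
    also have "\<dots> \<le> ?f x + ?f (0 + (-1) * x)"
      by (cases "0 \<le> x") (auto simp: indicator_def)
    finally show "ennreal ((\<bar>x\<bar> + 1) * phi \<sigma> x) \<le> ?f x + ?f (0 + (-1) * x)" .
  qed
  also have "\<dots> = (\<integral>\<^sup>+x. ?f x \<partial>lborel) + (\<integral>\<^sup>+x. ?f (0 + (-1) * x) \<partial>lborel)"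
    by (rule nn_integral_add) measurable
  also have "(\<integral>\<^sup>+x. ?f (0 + (-1) * x) \<partial>lborel) = (\<integral>\<^sup>+x. ?f x \<partial>lborel)"
    using nn_integral_real_affine[of ?f "-1" 0] by simp
  finally have "(\<integral>\<^sup>+x. ennreal ((\<bar>x\<bar> + 1) * phi \<sigma> x) \<partial>lborel) \<le> ennreal (2 * D / (\<alpha> - 1))"
    using D exponent unfolding half by (simp flip: ennreal_plus)
  with D exponent show ?thesis by (intro that[of "2 * D / (\<alpha> - 1)"]) auto
qed

end

section \<open>Sampling error of functions of one variable\<close>

context decaying_sigmoid
begin

lemma phi_scaled_integral:
  assumes W: "(\<integral>\<^sup>+u. ennreal ((\<bar>u\<bar> + 1) * phi \<sigma> u) \<partial>lborel) \<le> ennreal W" and n: "0 < n"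
  shows "(\<integral>\<^sup>+x. ennreal (phi \<sigma> (n * x - of_int k)) \<partial>lborel) \<le> ennreal (W / n)"
proof -
  have "(\<integral>\<^sup>+x. ennreal (phi \<sigma> (n * x - of_int k)) \<partial>lborel) =
      ennreal \<bar>1 / n\<bar> * (\<integral>\<^sup>+u. ennreal (phi \<sigma> (n * (of_int k / n + 1 / n * u) - of_int k)) \<partial>lborel)"
    using n by (intro nn_integral_real_affine) auto
  also have "(\<lambda>u. phi \<sigma> (n * (of_int k / n + 1 / n * u) - of_int k)) = phi \<sigma>"
    using n by (auto simp: field_simps)
  also have "(\<integral>\<^sup>+u. ennreal (phi \<sigma> u) \<partial>lborel) \<le>
      (\<integral>\<^sup>+u. ennreal ((\<bar>u\<bar> + 1) * phi \<sigma> u) \<partial>lborel)"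
    using phi_nonneg by (intro nn_integral_mono ennreal_leI) (simp add: distrib_right)
  also have "\<dots> \<le> ennreal W" by (rule W)
  finally show ?thesis using n by (simp add: ennreal_mult'[symmetric] mult_left_mono)
qed

text \<open>Substituting \<open>u = n x - k\<close> in the term of index \<open>k\<close> frees the kernel from \<open>k\<close>. What is left under
  the integral is the sum, over all nodes, of the oscillations of \<open>G\<close> at the common offset \<open>u/n\<close>;
  it is at most \<open>(\<bar>u\<bar> + 1) V\<close>. The total variation of \<open>G\<close> governs the error, and its modulus of
  continuity does not enter.\<close>
lemma monotone_sampling_integral:
  assumes W: "(\<integral>\<^sup>+u. ennreal ((\<bar>u\<bar> + 1) * phi \<sigma> u) \<partial>lborel) \<le> ennreal W"
    and G: "mono G" "\<And>x. 0 \<le> G x" "\<And>x. G x \<le> V"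
    and K: "finite K" and n: "0 < n"
  shows "(\<integral>\<^sup>+x. ennreal (\<Sum>k\<in>K. \<bar>G (of_int k / n) - G x\<bar> * phi \<sigma> (n * x - of_int k)) \<partial>lborel)
    \<le> ennreal (V * W / n)"
proof -
  have [measurable]: "G \<in> borel_measurable borel" by (rule borel_measurable_mono[OF G(1)])
  have V: "0 \<le> V" using G(2,3)[of 0] by linarith
  let ?d = "\<lambda>k u. \<bar>G (of_int k / n) - G ((of_int k + u) / n)\<bar>"
  have subst: "(\<integral>\<^sup>+x. ennreal (\<bar>G (of_int k / n) - G x\<bar> * phi \<sigma> (n * x - of_int k)) \<partial>lborel)
      = ennreal (1 / n) * (\<integral>\<^sup>+u. ennreal (?d k u * phi \<sigma> u) \<partial>lborel)" for k :: int
  proof -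
    have "(\<integral>\<^sup>+x. ennreal (\<bar>G (of_int k / n) - G x\<bar> * phi \<sigma> (n * x - of_int k)) \<partial>lborel)
      = ennreal \<bar>1 / n\<bar> * (\<integral>\<^sup>+u. ennreal (\<bar>G (of_int k / n) - G (of_int k / n + 1 / n * u)\<bar> *
          phi \<sigma> (n * (of_int k / n + 1 / n * u) - of_int k)) \<partial>lborel)"
      using n by (intro nn_integral_real_affine) auto
    moreover have "n * (of_int k / n + 1 / n * u) - of_int k = u"
      "of_int k / n + 1 / n * u = (of_int k + u) / n" for u
      using n by (auto simp: field_simps)
    ultimately show ?thesis using n by simp
  qed
  have "(\<Sum>k\<in>K. \<integral>\<^sup>+u. ennreal (?d k u * phi \<sigma> u) \<partial>lborel) =
      (\<integral>\<^sup>+u. (\<Sum>k\<in>K. ennreal (?d k u * phi \<sigma> u)) \<partial>lborel)"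
    by (intro nn_integral_sum[symmetric]) measurable
  also have "\<dots> \<le> (\<integral>\<^sup>+u. ennreal V * ennreal ((\<bar>u\<bar> + 1) * phi \<sigma> u) \<partial>lborel)"
  proof (rule nn_integral_mono)
    fix u :: real
    have "(\<Sum>k\<in>K. ennreal (?d k u * phi \<sigma> u)) = ennreal ((\<Sum>k\<in>K. ?d k u) * phi \<sigma> u)"
      by (simp add: sum_ennreal phi_nonneg sum_distrib_right)
    also have "\<dots> \<le> ennreal ((\<bar>u\<bar> + 1) * (V - 0) * phi \<sigma> u)"
      by (intro ennreal_leI mult_right_mono sum_oscillation_le G K n phi_nonneg)
    also have "\<dots> = ennreal V * ennreal ((\<bar>u\<bar> + 1) * phi \<sigma> u)"
      using V by (simp add: ennreal_mult'[symmetric] mult_ac)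
    finally show "(\<Sum>k\<in>K. ennreal (?d k u * phi \<sigma> u)) \<le> ennreal V * ennreal ((\<bar>u\<bar> + 1) * phi \<sigma> u)" .
  qed
  also have "\<dots> = ennreal V * (\<integral>\<^sup>+u. ennreal ((\<bar>u\<bar> + 1) * phi \<sigma> u) \<partial>lborel)"
    by (rule nn_integral_cmult) measurable
  also have "\<dots> \<le> ennreal V * ennreal W" by (intro mult_left_mono W) auto
  finally have le: "(\<Sum>k\<in>K. \<integral>\<^sup>+u. ennreal (?d k u * phi \<sigma> u) \<partial>lborel) \<le> ennreal V * ennreal W" .
  have "(\<integral>\<^sup>+x. ennreal (\<Sum>k\<in>K. \<bar>G (of_int k / n) - G x\<bar> * phi \<sigma> (n * x - of_int k)) \<partial>lborel)
      = (\<integral>\<^sup>+x. (\<Sum>k\<in>K. ennreal (\<bar>G (of_int k / n) - G x\<bar> * phi \<sigma> (n * x - of_int k))) \<partial>lborel)"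
    by (intro nn_integral_cong) (simp add: sum_ennreal phi_nonneg)
  also have "\<dots> = (\<Sum>k\<in>K. \<integral>\<^sup>+x. ennreal (\<bar>G (of_int k / n) - G x\<bar> * phi \<sigma> (n * x - of_int k)) \<partial>lborel)"
    by (intro nn_integral_sum) measurable
  also have "\<dots> = ennreal (1 / n) * (\<Sum>k\<in>K. \<integral>\<^sup>+u. ennreal (?d k u * phi \<sigma> u) \<partial>lborel)"
    by (simp only: subst sum_distrib_left)
  also have "\<dots> \<le> ennreal (1 / n) * (ennreal V * ennreal W)" by (intro mult_left_mono le) auto
  also have "\<dots> = ennreal (V * W / n)"
    using V n by (simp add: ennreal_mult'[symmetric])
  finally show ?thesis .
qed

end

lemma subdivision_le:
  assumes "subdivision c d q l" "i \<le> j" "j \<le> q"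
  shows "l i \<le> l j"
  using assms(2,3)
proof (induction j rule: dec_induct)
  case (step m)
  hence "l i \<le> l m" "l m < l (Suc m)" using assms(1) by (auto simp: subdivision_def)
  thus ?case by linarith
qed simp

lemma subdivision_locate:
  assumes l: "subdivision c d q l" and x: "c \<le> x" "x < d"
  obtains i where "i < q" "l i \<le> x" "x < l (Suc i)"
proof -
  define j where "j = (LEAST j. x < l j)"
  have q: "x < l q" using l x by (simp add: subdivision_def)
  hence j: "x < l j" "j \<le> q" unfolding j_def by (auto intro: LeastI Least_le)
  have "j \<noteq> 0"
  proof
    assume "j = 0"
    thus False using j(1) l x by (simp add: subdivision_def)
  qed
  then obtain i where i: "j = Suc i" by (cases j) auto
  hence "\<not> x < l i" unfolding j_def using not_less_Least[of i "\<lambda>j. x < l j"] by simp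
  thus ?thesis using that[of i] i j by simp
qed

lemma subdivision_locate_open:
  assumes l: "subdivision c d q l" and x: "x \<in> {c..d}" "x \<notin> l ` {..q}"
  obtains i where "i < q" "x \<in> {l i<..<l (Suc i)}"
proof -
  have "c \<noteq> x" "d \<noteq> x" using l x by (auto simp: subdivision_def)
  then obtain i where i: "i < q" "l i \<le> x" "x < l (Suc i)"
    using subdivision_locate[OF l, of x] x by auto
  moreover have "l i \<noteq> x" using x i by auto
  ultimately show ?thesis using that[of i] by auto
qed

lemma subdivision_piece_subset:
  assumes l: "subdivision c d q l" and i: "i < q"
  shows "{l i<..<l (Suc i)} \<subseteq> {c..d}"
  using subdivision_le[OF l, of 0 i] subdivision_le[OF l, of "Suc i" q] i l
  by (auto simp: subdivision_def)

text \<open>\<open>G\<close> is a substitute for the variation function of \<open>g\<close>. Besides following the monotone pieces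
  of \<open>g\<close> it jumps by at least \<open>2 B\<close> on either side of every breakpoint within \<open>[c, d]\<close>, which pays for the
  arbitrary values of \<open>g\<close> at the breakpoints and for its jumps across them.\<close>
lemma piecewise_monotone_dominated:
  fixes g l :: "_ \<Rightarrow> real"
  assumes l: "subdivision c d q l"
    and mono: "\<And>i. i < q \<Longrightarrow> mono_on {l i<..<l (Suc i)} g \<or> mono_on {l i<..<l (Suc i)} (\<lambda>x. - g x)"
    and B: "\<And>x. x \<in> {c..d} \<Longrightarrow> \<bar>g x\<bar> \<le> B"
  obtains G where "mono G" "\<And>x. 0 \<le> G x" "\<And>x. G x \<le> 8 * B * real q"
    "\<And>x y. x \<in> {c..d} \<Longrightarrow> y \<in> {c..d} \<Longrightarrow> \<bar>g x - g y\<bar> \<le> \<bar>G x - G y\<bar>"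
proof -
  have "c \<le> d" using l subdivision_le[OF l, of 0 q] by (auto simp: subdivision_def)
  hence B0: "0 \<le> B" using B[of c] by auto
  define s where "s i = (if mono_on {l i<..<l (Suc i)} g then 1 else -1 :: real)" for i
  have s: "s i * g x \<le> s i * g y" if "i < q" "l i < x" "x \<le> y" "y < l (Suc i)" for i x y
    using that mono[OF that(1)] by (auto simp: s_def mono_on_def)
  have sB: "\<bar>s i * g x\<bar> \<le> B" if "i < q" "l i < x" "x < l (Suc i)" for i x
  proof -
    have "c \<le> l i" "l (Suc i) \<le> d"
      using subdivision_le[OF l, of 0 i] subdivision_le[OF l, of "Suc i" q] that l
      by (auto simp: subdivision_def)
    thus ?thesis using B[of x] that by (auto simp: s_def)
  qed
  \<comment> \<open>The shifted piece has values in \<open>[4 B, 6 B]\<close>, which leaves gaps of \<open>2 B\<close> to the values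
    \<open>2 B\<close> at its left endpoint and \<open>8 B\<close> from its right endpoint on.\<close>
  define J where "J i x = (if x < l i then 0 else if x = l i then 2 * B
    else if x < l (Suc i) then 5 * B + s i * g x else 8 * B)" for i x
  define G where "G x = (\<Sum>i<q. J i x)" for x
  have J0: "0 \<le> J i x" and J8: "J i x \<le> 8 * B" if "i < q" for i x
    using sB[OF that, of x] B0 by (auto simp: J_def)
  have JJ: "J i x \<le> J i y" if "i < q" "x \<le> y" for i x y
    using s[OF that(1), of x y] sB[OF that(1), of x] sB[OF that(1), of y] B0 that
    by (auto simp: J_def)
  have dom: "\<bar>g x - g y\<bar> \<le> \<bar>G x - G y\<bar>" if xy: "x \<in> {c..d}" "y \<in> {c..d}" "x < y" for x y
  proof -
    obtain i where i: "i < q" "l i \<le> x" "x < l (Suc i)"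
      using subdivision_locate[OF l, of x] xy by auto
    have "\<bar>g x - g y\<bar> \<le> J i y - J i x"
    proof (cases "l i < x \<and> y < l (Suc i)")
      case True
      thus ?thesis using s[OF i(1), of x y] i xy by (auto simp: J_def s_def)
    next
      case False
      hence "2 * B \<le> J i y - J i x"
        using i xy sB[OF i(1), of x] sB[OF i(1), of y] B0 by (auto simp: J_def)
      thus ?thesis using B[OF xy(1)] B[OF xy(2)] by linarith
    qed
    also have "\<dots> \<le> (\<Sum>i<q. J i y - J i x)"
      using i JJ[of _ x y] xy by (intro member_le_sum[of i "{..<q}" "\<lambda>i. J i y - J i x"]) auto
    also have "\<dots> = G y - G x" by (simp add: G_def sum_subtractf)
    finally show ?thesis by linarith
  qed
  show ?thesis
  proof
    show "mono G" by (auto simp: G_def mono_def intro!: sum_mono JJ)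
    show "0 \<le> G x" for x by (auto simp: G_def intro!: sum_nonneg J0)
    show "G x \<le> 8 * B * real q" for x
      using sum_bounded_above[of "{..<q}" "\<lambda>i. J i x" "8 * B"] J8 by (simp add: G_def mult_ac)
    show "\<bar>g x - g y\<bar> \<le> \<bar>G x - G y\<bar>" if "x \<in> {c..d}" "y \<in> {c..d}" for x y
      using dom[of x y] dom[of y x] that by (cases x y rule: linorder_cases) (auto simp: abs_minus_commute)
  qed
qed

section \<open>Partial derivatives on rectangles\<close>

lemma Basis_real_pair: "(Basis :: (real \<times> real) set) = {(1, 0), (0, 1)}"
  by (auto simp: Basis_prod_def)

lemma mem_cbox_real_pair:
  fixes a b :: "real \<times> real"
  shows "x \<in> cbox a b \<longleftrightarrow> fst x \<in> {fst a..fst b} \<and> snd x \<in> {snd a..snd b}"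
  by (cases a; cases b; cases x) (auto simp: cbox_Pair_eq)

lemma partial_deriv_open_subset:
  assumes "open U" "U \<subseteq> S" "x \<in> U"
  shows "partial_deriv S f e x = partial_deriv U f e x"
proof -
  have "open {t. x + t *\<^sub>R e \<in> U}"
  proof -
    have "open ((\<lambda>t. x + t *\<^sub>R e) -` U)"
      by (intro open_vimage assms continuous_intros)
    thus ?thesis by (simp add: vimage_def)
  qed
  hence "at 0 within {t. x + t *\<^sub>R e \<in> S} = at 0" "at 0 within {t. x + t *\<^sub>R e \<in> U} = at 0"
    using assms by (auto intro!: at_within_open_subset[of _ "{t. x + t *\<^sub>R e \<in> U}"])
  thus ?thesis by (simp add: partial_deriv_def)
qed

lemma C1_on_has_partial_derivs:
  assumes "C1_on S f" "(x, y) \<in> S"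
  shows "((\<lambda>s. f (s, y)) has_real_derivative partial_deriv S f (1, 0) (x, y)) (at x within {s. (s, y) \<in> S})"
    and "((\<lambda>s. f (x, s)) has_real_derivative partial_deriv S f (0, 1) (x, y)) (at y within {s. (x, s) \<in> S})"
proof -
  have *: "((\<lambda>t. f ((x, y) + t *\<^sub>R e)) has_real_derivative partial_deriv S f e (x, y))
      (at 0 within {t. (x, y) + t *\<^sub>R e \<in> S})" if "e \<in> Basis" for e
    using assms that unfolding C1_on_def partial_deriv_def
    by (auto simp: has_real_derivative_iff_has_vector_derivative vector_derivative_works)
  have "(+) x ` {t. (x + t, y) \<in> S} = {s. (s, y) \<in> S}"
    by (force simp: image_iff intro: exI[of _ "_ - x"])
  with *[of "(1, 0)"]
  show "((\<lambda>s. f (s, y)) has_real_derivative partial_deriv S f (1, 0) (x, y)) (at x within {s. (s, y) \<in> S})"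
    using DERIV_at_within_shift[of "\<lambda>s. f (s, y)" _ x 0 "{t. (x + t, y) \<in> S}"]
    by (simp add: Basis_real_pair)
  have "(+) y ` {t. (x, y + t) \<in> S} = {s. (x, s) \<in> S}"
    by (force simp: image_iff intro: exI[of _ "_ - y"])
  with *[of "(0, 1)"]
  show "((\<lambda>s. f (x, s)) has_real_derivative partial_deriv S f (0, 1) (x, y)) (at y within {s. (x, s) \<in> S})"
    using DERIV_at_within_shift[of "\<lambda>s. f (x, s)" _ y 0 "{t. (x, y + t) \<in> S}"]
    by (simp add: Basis_real_pair)
qed

text \<open>The mean value theorem on the two legs of an L-shaped path, which stays in the rectangle.\<close>
lemma C1_on_rectangle_lipschitz:
  assumes f: "C1_on (A \<times> B) f" and conv: "convex A" "convex B"
    and L: "\<And>z e. z \<in> A \<times> B \<Longrightarrow> e \<in> Basis \<Longrightarrow> \<bar>partial_deriv (A \<times> B) f e z\<bar> \<le> L"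
    and xy: "(x, y) \<in> A \<times> B" "(x', y') \<in> A \<times> B"
  shows "\<bar>f (x, y) - f (x', y')\<bar> \<le> L * (\<bar>x - x'\<bar> + \<bar>y - y'\<bar>)"
proof -
  have "norm (f (x, y) - f (x', y)) \<le> L * norm (x - x')"
  proof (rule field_differentiable_bound[OF conv(1)])
    fix s assume s: "s \<in> A"
    have "{s. (s, y) \<in> A \<times> B} = A" using xy by auto
    thus "((\<lambda>s. f (s, y)) has_field_derivative partial_deriv (A \<times> B) f (1, 0) (s, y)) (at s within A)"
      using C1_on_has_partial_derivs(1)[OF f, of s y] s xy by auto
    show "norm (partial_deriv (A \<times> B) f (1, 0) (s, y)) \<le> L"
      using L[of "(s, y)" "(1, 0)"] s xy by (auto simp: Basis_real_pair)
  qed (use xy in auto)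
  moreover have "norm (f (x', y) - f (x', y')) \<le> L * norm (y - y')"
  proof (rule field_differentiable_bound[OF conv(2)])
    fix s assume s: "s \<in> B"
    have "{s. (x', s) \<in> A \<times> B} = B" using xy by auto
    thus "((\<lambda>s. f (x', s)) has_field_derivative partial_deriv (A \<times> B) f (0, 1) (x', s)) (at s within B)"
      using C1_on_has_partial_derivs(2)[OF f, of x' s] s xy by auto
    show "norm (partial_deriv (A \<times> B) f (0, 1) (x', s)) \<le> L"
      using L[of "(x', s)" "(0, 1)"] s xy by (auto simp: Basis_real_pair)
  qed (use xy in auto)
  ultimately show ?thesis by (simp add: distrib_left)
qed

lemma l1_lipschitz_continuous_on:
  fixes f :: "real \<times> real \<Rightarrow> real"
  assumes "\<And>z w. z \<in> S \<Longrightarrow> w \<in> S \<Longrightarrow> \<bar>f z - f w\<bar> \<le> L * (\<bar>fst z - fst w\<bar> + \<bar>snd z - snd w\<bar>)"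
  shows "continuous_on S f"
  unfolding continuous_on_def
proof
  fix z assume z: "z \<in> S"
  have lim: "((\<lambda>w. L * (\<bar>fst w - fst z\<bar> + \<bar>snd w - snd z\<bar>)) \<longlongrightarrow> 0) (at z within S)"
    by (auto intro!: tendsto_eq_intros)
  have "((\<lambda>w. f w - f z) \<longlongrightarrow> 0) (at z within S)"
  proof (rule Lim_null_comparison[OF _ lim])
    show "\<forall>\<^sub>F w in at z within S. norm (f w - f z) \<le> L * (\<bar>fst w - fst z\<bar> + \<bar>snd w - snd z\<bar>)"
      using assms z by (auto simp: eventually_at_filter)
  qed
  thus "(f \<longlongrightarrow> f z) (at z within S)" by (simp add: LIM_zero_iff)
qed

text \<open>By Rolle's theorem \<open>h\<close> is injective, and a continuous injective function on an interval is
  strictly monotone.\<close>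
lemma derivative_nonzero_imp_monotone:
  fixes h :: "real \<Rightarrow> real"
  assumes der: "\<And>x. x \<in> {r<..<s} \<Longrightarrow> (h has_real_derivative h' x) (at x)"
    and nz: "\<And>x. x \<in> {r<..<s} \<Longrightarrow> h' x \<noteq> 0"
  shows "mono_on {r<..<s} h \<or> mono_on {r<..<s} (\<lambda>x. - h x)"
proof -
  have "h x \<noteq> h y" if xy: "x \<in> {r<..<s}" "y \<in> {r<..<s}" "x < y" for x y
  proof -
    obtain z where "x < z" "z < y" "h y - h x = (y - x) * h' z"
      using MVT2[OF xy(3), of h h'] der xy by auto
    thus ?thesis using nz[of z] xy by auto
  qed
  hence "inj_on h {r<..<s}" by (metis inj_onI linorder_neqE)
  moreover have "continuous_on {r<..<s} h"
    using der by (blast intro: continuous_at_imp_continuous_on DERIV_isCont)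
  ultimately have "strict_mono_on {r<..<s} h \<or> strict_antimono_on {r<..<s} h"
    using injective_eq_monotone_map[of "{r<..<s}" h] by (simp add: is_interval_oo)
  thus ?thesis
  proof
    assume "strict_mono_on {r<..<s} h"
    thus ?thesis using strict_mono_on_imp_mono_on by blast
  next
    assume "strict_antimono_on {r<..<s} h"
    hence "mono_on {r<..<s} (\<lambda>x. - h x)"
      by (intro mono_onI) (metis monotone_onD neg_le_iff_le less_eq_real_def)
    thus ?thesis by blast
  qed
qed

lemma abs_le_powr_inverse:
  fixes x M p :: real
  assumes "\<bar>x\<bar> powr p \<le> M" "1 \<le> p"
  shows "\<bar>x\<bar> \<le> M powr (1 / p)"
proof -
  have "\<bar>x\<bar> = (\<bar>x\<bar> powr p) powr (1 / p)" using assms by (simp add: powr_powr)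
  also have "\<dots> \<le> M powr (1 / p)" using assms by (intro powr_mono2) auto
  finally show ?thesis .
qed

section \<open>Norms on rectangles\<close>

lemma Lp_norm_nonneg: "0 \<le> Lp_norm p S u"
  by (simp add: Lp_norm_def)

lemma W1p_norm_nonneg: "0 \<le> W1p_norm p S u"
  by (simp add: W1p_norm_def Lp_norm_nonneg sum_nonneg)

lemma Lp_norm_le_sup:
  fixes a b :: "real \<times> real"
  assumes p: "1 \<le> p" and c: "0 \<le> c" and u: "\<And>x. x \<in> cbox a b \<Longrightarrow> \<bar>u x\<bar> \<le> c"
  shows "Lp_norm p (cbox a b) u \<le> c * measure lebesgue (cbox a b) powr (1 / p)"
proof -
  let ?M = "lebesgue_on (cbox a b)"
  have "(\<integral>x. \<bar>u x\<bar> powr p \<partial>?M) \<le> c powr p * measure lebesgue (cbox a b)"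
  proof (cases "integrable ?M (\<lambda>x. \<bar>u x\<bar> powr p)")
    case True
    have "(\<integral>x. \<bar>u x\<bar> powr p \<partial>?M) \<le> (\<integral>x. c powr p \<partial>?M)"
    proof (rule integral_mono[OF True])
      show "integrable ?M (\<lambda>x. c powr p)" by (rule continuous_imp_integrable) simp
    qed (use p u in \<open>auto intro!: powr_mono2\<close>)
    also have "\<dots> = c powr p * measure lebesgue (cbox a b)"
      by (simp add: measure_restrict_space)
    finally show ?thesis .
  next
    case False
    thus ?thesis by (simp add: not_integrable_integral_eq)
  qed
  hence "Lp_norm p (cbox a b) u \<le> (c powr p * measure lebesgue (cbox a b)) powr (1 / p)"
    unfolding Lp_norm_def using p by (intro powr_mono2) auto
  also have "\<dots> = c * measure lebesgue (cbox a b) powr (1 / p)"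
    using p c by (simp add: powr_mult powr_powr)
  finally show ?thesis .
qed

lemma Lp_norm_ge_inf:
  fixes a b :: "real \<times> real"
  assumes p: "1 \<le> p" and "continuous_on (cbox a b) u" and \<beta>: "0 \<le> \<beta>"
    and u: "\<And>x. x \<in> cbox a b \<Longrightarrow> \<beta> \<le> \<bar>u x\<bar> powr p"
  shows "\<beta> powr (1 / p) * measure lebesgue (cbox a b) powr (1 / p) \<le> Lp_norm p (cbox a b) u"
proof -
  let ?M = "lebesgue_on (cbox a b)"
  have "continuous_on (cbox a b) (\<lambda>x. \<bar>u x\<bar> powr p)"
    using assms by (intro continuous_on_powr' continuous_intros) auto
  hence int: "integrable ?M (\<lambda>x. \<bar>u x\<bar> powr p)" by (rule continuous_imp_integrable)
  have "\<beta> * measure lebesgue (cbox a b) = (\<integral>x. \<beta> \<partial>?M)"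
    by (simp add: measure_restrict_space)
  also have "\<dots> \<le> (\<integral>x. \<bar>u x\<bar> powr p \<partial>?M)"
  proof (rule integral_mono[OF _ int])
    show "integrable ?M (\<lambda>x. \<beta>)" by (rule continuous_imp_integrable) simp
  qed (use u in auto)
  finally have "(\<beta> * measure lebesgue (cbox a b)) powr (1 / p) \<le> Lp_norm p (cbox a b) u"
    unfolding Lp_norm_def using p \<beta> by (intro powr_mono2) auto
  thus ?thesis by (simp add: powr_mult)
qed

text \<open>The inequality \<open>\<bar>u\<bar>\<^sup>p \<le> c\<^sup>p\<^sup>-\<^sup>1 \<bar>u\<bar>\<close> trades a mean error for an error in \<open>L\<^sup>p\<close>. The mean error enters
  through a Borel majorant \<open>h\<close>, since this is what Tonelli's theorem can integrate; \<open>u\<close> itself may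
  be irregular on the grid lines.\<close>
lemma Lp_norm_le_L1_majorant:
  fixes a b :: "real \<times> real" and h :: "real \<times> real \<Rightarrow> real"
  assumes p: "1 \<le> p" and c: "0 \<le> c" and u: "\<And>x. x \<in> cbox a b \<Longrightarrow> \<bar>u x\<bar> \<le> c"
    and [measurable]: "h \<in> borel_measurable borel"
    and le: "AE x in lebesgue. x \<in> cbox a b \<longrightarrow> \<bar>u x\<bar> \<le> h x"
    and D: "(\<integral>\<^sup>+x. ennreal (h x) * indicator (cbox a b) x \<partial>lborel) \<le> ennreal D" "0 \<le> D"
  shows "Lp_norm p (cbox a b) u \<le> (c powr (p - 1) * D) powr (1 / p)"
proof -
  let ?M = "lebesgue_on (cbox a b)"
  have "(\<integral>x. \<bar>u x\<bar> powr p \<partial>?M) \<le> c powr (p - 1) * D"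
  proof (cases "integrable ?M (\<lambda>x. \<bar>u x\<bar> powr p)")
    case True
    have "ennreal (\<integral>x. \<bar>u x\<bar> powr p \<partial>?M) = (\<integral>\<^sup>+x. ennreal (\<bar>u x\<bar> powr p) \<partial>?M)"
      by (intro nn_integral_eq_integral[symmetric] True) simp
    also have "\<dots> = (\<integral>\<^sup>+x. ennreal (\<bar>u x\<bar> powr p) * indicator (cbox a b) x \<partial>lebesgue)"
      by (intro nn_integral_restrict_space) simp
    also have "\<dots> \<le> (\<integral>\<^sup>+x. ennreal (c powr (p - 1)) * (ennreal (h x) * indicator (cbox a b) x) \<partial>lebesgue)"
    proof (rule nn_integral_mono_AE)
      show "AE x in lebesgue. ennreal (\<bar>u x\<bar> powr p) * indicator (cbox a b) x \<le>
          ennreal (c powr (p - 1)) * (ennreal (h x) * indicator (cbox a b) x)"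
        using le
      proof eventually_elim
        case (elim x)
        show ?case
        proof (cases "x \<in> cbox a b")
          case True
          have "\<bar>u x\<bar> powr p = \<bar>u x\<bar> powr (p - 1) * \<bar>u x\<bar>"
            using powr_add[of "\<bar>u x\<bar>" "p - 1" 1] by (cases "u x = 0") simp_all
          also have "\<dots> \<le> c powr (p - 1) * h x"
            using elim True u[OF True] p by (intro mult_mono powr_mono2) auto
          finally show ?thesis using True by (simp add: ennreal_mult'[symmetric] ennreal_leI)
        qed simp
      qed
    qed
    also have "\<dots> = (\<integral>\<^sup>+x. ennreal (c powr (p - 1)) * (ennreal (h x) * indicator (cbox a b) x) \<partial>lborel)"
      by (rule nn_integral_completion)
    also have "\<dots> = ennreal (c powr (p - 1)) * (\<integral>\<^sup>+x. ennreal (h x) * indicator (cbox a b) x \<partial>lborel)"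
      by (rule nn_integral_cmult) measurable
    also have "\<dots> \<le> ennreal (c powr (p - 1)) * ennreal D" by (intro mult_left_mono D) auto
    also have "\<dots> = ennreal (c powr (p - 1) * D)" by (simp add: ennreal_mult')
    finally show ?thesis using D by (simp add: ennreal_le_iff)
  next
    case False
    thus ?thesis using D by (simp add: not_integrable_integral_eq)
  qed
  thus ?thesis unfolding Lp_norm_def using p by (intro powr_mono2) auto
qed

section \<open>The operators as weighted averages\<close>

lemma sample_point: "real_pair k /\<^sub>R n = (of_int (fst k) / n, of_int (snd k) / n)"
  by (simp add: real_pair_def divide_inverse mult.commute)

lemma Psi_grid: "Psi \<sigma> (n *\<^sub>R x - real_pair k) =
    phi \<sigma> (n * fst x - of_int (fst k)) * phi \<sigma> (n * snd x - of_int (snd k))"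
  by (simp add: Psi_def real_pair_def)

lemma finite_grid_idx [simp]: "finite (grid_idx a b n)"
  by (simp add: grid_idx_def)

lemma sample_point_in_box:
  assumes "0 < n" "k \<in> grid_idx a b n"
  shows "real_pair k /\<^sub>R real n \<in> cbox a b"
  using assms unfolding sample_point mem_cbox_real_pair grid_idx_def
  by (auto simp: field_simps le_floor_iff ceiling_le_iff)

text \<open>A closed interval of length at least 1 contains an integer.\<close>
lemma grid_idx_empty_bound:
  assumes "grid_idx a b n = {}" "fst a < fst b" "snd a < snd b"
  shows "real n \<le> 1 / (fst b - fst a) + 1 / (snd b - snd a)"
proof -
  have *: "real n \<le> 1 / (d - c)" if "{\<lceil>real n * c\<rceil>..\<lfloor>real n * d\<rfloor>} = {}" "c < d" for c d
  proof -
    have "real n * d - real n * c \<le> 1" using that(1) by simp linarith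
    thus ?thesis using that(2) by (simp add: field_simps)
  qed
  have pos: "0 < 1 / (fst b - fst a)" "0 < 1 / (snd b - snd a)" using assms by auto
  from assms(1) have "{\<lceil>real n * fst a\<rceil>..\<lfloor>real n * fst b\<rfloor>} = {} \<or>
      {\<lceil>real n * snd a\<rceil>..\<lfloor>real n * snd b\<rfloor>} = {}"
    unfolding grid_idx_def by blast
  thus ?thesis
    using *[of "fst a" "fst b"] *[of "snd a" "snd b"] assms(2,3) pos by linarith
qed

lemma nearest_index:
  fixes n c d x :: real
  assumes "{\<lceil>n * c\<rceil>..\<lfloor>n * d\<rfloor>} \<noteq> {}" "x \<in> {c..d}" "0 < n"
  obtains k where "k \<in> {\<lceil>n * c\<rceil>..\<lfloor>n * d\<rfloor>}" "\<bar>n * x - of_int k\<bar> \<le> 1"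
proof (rule that)
  have "n * c \<le> n * x" "n * x \<le> n * d" using assms by auto
  moreover have "\<lceil>n * c\<rceil> \<le> \<lfloor>n * d\<rfloor>" using assms(1) by simp
  ultimately show "max \<lceil>n * c\<rceil> \<lfloor>n * x\<rfloor> \<in> {\<lceil>n * c\<rceil>..\<lfloor>n * d\<rfloor>}"
    "\<bar>n * x - of_int (max \<lceil>n * c\<rceil> \<lfloor>n * x\<rfloor>)\<bar> \<le> 1"
    by (auto simp: max_def floor_mono) linarith+
qed

context decaying_sigmoid
begin

lemma denominator_ge:
  assumes x: "x \<in> cbox a b" and n: "0 < n" and ne: "grid_idx a b n \<noteq> {}"
  shows "kappa\<^sup>2 \<le> (\<Sum>k\<in>grid_idx a b n. Psi \<sigma> (real n *\<^sub>R x - real_pair k))"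
proof -
  from ne have ne': "{\<lceil>real n * fst a\<rceil>..\<lfloor>real n * fst b\<rfloor>} \<noteq> {}" "{\<lceil>real n * snd a\<rceil>..\<lfloor>real n * snd b\<rfloor>} \<noteq> {}"
    by (auto simp: grid_idx_def)
  from x have x': "fst x \<in> {fst a..fst b}" "snd x \<in> {snd a..snd b}" by (simp_all add: mem_cbox_real_pair)
  obtain i where i: "i \<in> {\<lceil>real n * fst a\<rceil>..\<lfloor>real n * fst b\<rfloor>}" "\<bar>real n * fst x - of_int i\<bar> \<le> 1"
    using nearest_index[OF ne'(1) x'(1)] n by auto
  obtain j where j: "j \<in> {\<lceil>real n * snd a\<rceil>..\<lfloor>real n * snd b\<rfloor>}" "\<bar>real n * snd x - of_int j\<bar> \<le> 1"
    using nearest_index[OF ne'(2) x'(2)] n by auto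
  have "kappa\<^sup>2 \<le> Psi \<sigma> (real n *\<^sub>R x - real_pair (i, j))"
    unfolding Psi_grid power2_eq_square using i j kappa_pos
    by (intro mult_mono phi_ge_kappa) (auto intro: phi_nonneg)
  also have "\<dots> \<le> (\<Sum>k\<in>grid_idx a b n. Psi \<sigma> (real n *\<^sub>R x - real_pair k))"
    using i j by (intro member_le_sum Psi_nonneg) (auto simp: grid_idx_def)
  finally show ?thesis .
qed

lemma NN_op_minus_eq:
  assumes x: "x \<in> cbox a b" and n: "0 < n" and ne: "grid_idx a b n \<noteq> {}"
  shows "NN_op \<sigma> a b n f x - c =
    (\<Sum>k\<in>grid_idx a b n. (f (real_pair k /\<^sub>R real n) - c) * Psi \<sigma> (real n *\<^sub>R x - real_pair k)) /
    (\<Sum>k\<in>grid_idx a b n. Psi \<sigma> (real n *\<^sub>R x - real_pair k))"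
proof -
  have "(\<Sum>k\<in>grid_idx a b n. Psi \<sigma> (real n *\<^sub>R x - real_pair k)) > 0"
    using denominator_ge[OF assms] kappa_pos by (meson less_le_trans zero_less_power)
  thus ?thesis
    by (simp add: NN_op_def field_simps sum_subtractf sum_distrib_left)
qed

text \<open>The operator is a weighted mean of node values, so it deviates from a number \<open>c\<close> by at most the
  weighted mean of the deviations at the nodes.\<close>
lemma NN_op_error_le:
  assumes x: "x \<in> cbox a b" and n: "0 < n" and ne: "grid_idx a b n \<noteq> {}"
  shows "\<bar>NN_op \<sigma> a b n f x - c\<bar> \<le>
    (\<Sum>k\<in>grid_idx a b n. \<bar>f (real_pair k /\<^sub>R real n) - c\<bar> * Psi \<sigma> (real n *\<^sub>R x - real_pair k)) / kappa\<^sup>2"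
proof -
  let ?S = "\<Sum>k\<in>grid_idx a b n. Psi \<sigma> (real n *\<^sub>R x - real_pair k)"
  have S: "kappa\<^sup>2 \<le> ?S" "0 < kappa\<^sup>2" using denominator_ge[OF assms] kappa_pos by auto
  hence abs_S: "\<bar>?S\<bar> = ?S" by linarith
  have "\<bar>NN_op \<sigma> a b n f x - c\<bar> \<le>
     (\<Sum>k\<in>grid_idx a b n. \<bar>f (real_pair k /\<^sub>R real n) - c\<bar> * Psi \<sigma> (real n *\<^sub>R x - real_pair k)) / ?S"
  proof -
    have "\<bar>NN_op \<sigma> a b n f x - c\<bar> =
        \<bar>\<Sum>k\<in>grid_idx a b n. (f (real_pair k /\<^sub>R real n) - c) * Psi \<sigma> (real n *\<^sub>R x - real_pair k)\<bar> / ?S"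
      unfolding NN_op_minus_eq[OF assms] abs_divide abs_S ..
    also have "\<dots> \<le> (\<Sum>k\<in>grid_idx a b n.
        \<bar>(f (real_pair k /\<^sub>R real n) - c) * Psi \<sigma> (real n *\<^sub>R x - real_pair k)\<bar>) / ?S"
      using S by (intro divide_right_mono sum_abs) linarith
    finally show ?thesis by (simp add: abs_mult abs_of_nonneg[OF Psi_nonneg])
  qed
  also have "\<dots> \<le> (\<Sum>k\<in>grid_idx a b n. \<bar>f (real_pair k /\<^sub>R real n) - c\<bar> * Psi \<sigma> (real n *\<^sub>R x - real_pair k)) / kappa\<^sup>2"
    using S by (intro divide_left_mono sum_nonneg mult_nonneg_nonneg Psi_nonneg abs_ge_zero)
      (auto intro!: mult_pos_pos less_le_trans[OF S(2) S(1)])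
  finally show ?thesis .
qed

lemma NN_op_bounded:
  assumes x: "x \<in> cbox a b" and n: "0 < n" and B: "\<And>x. x \<in> cbox a b \<Longrightarrow> \<bar>f x\<bar> \<le> B"
  shows "\<bar>NN_op \<sigma> a b n f x\<bar> \<le> B"
proof (cases "grid_idx a b n = {}")
  case True
  thus ?thesis using B[OF x] by (simp add: NN_op_def)
next
  case False
  let ?S = "\<Sum>k\<in>grid_idx a b n. Psi \<sigma> (real n *\<^sub>R x - real_pair k)"
  have S: "0 < ?S" using denominator_ge[OF x n False] kappa_pos by (meson less_le_trans zero_less_power)
  have "\<bar>\<Sum>k\<in>grid_idx a b n. f (real_pair k /\<^sub>R real n) * Psi \<sigma> (real n *\<^sub>R x - real_pair k)\<bar>
      \<le> (\<Sum>k\<in>grid_idx a b n. B * Psi \<sigma> (real n *\<^sub>R x - real_pair k))"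
    unfolding abs_mult abs_of_nonneg[OF Psi_nonneg]
    by (intro order.trans[OF sum_abs] sum_mono)
      (simp add: abs_mult abs_of_nonneg[OF Psi_nonneg] mult_right_mono B sample_point_in_box n Psi_nonneg)
  also have "\<dots> = B * ?S" by (simp add: sum_distrib_left)
  finally show ?thesis using S by (simp add: NN_op_def abs_divide pos_divide_le_eq)
qed

end

section \<open>The estimate for continuously differentiable functions\<close>

lemma sum_product_weights:
  fixes g h :: "int \<Rightarrow> real"
  assumes "finite A" "finite B"
  shows "(\<Sum>k\<in>A \<times> B. (u (fst k) + v (snd k)) * (g (fst k) * h (snd k))) =
    (\<Sum>i\<in>A. u i * g i) * (\<Sum>j\<in>B. h j) + (\<Sum>i\<in>A. g i) * (\<Sum>j\<in>B. v j * h j)"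
  unfolding sum_product sum.cartesian_product sum.distrib[symmetric]
  by (rule sum.cong) (auto simp: algebra_simps)

context decaying_sigmoid
begin

lemma NN_op_lipschitz_error:
  assumes m: "\<And>u K. finite K \<Longrightarrow> (\<Sum>k\<in>K. \<bar>u - of_int k\<bar> * phi \<sigma> (u - of_int k)) \<le> m"
    and lip: "\<And>z w. z \<in> cbox a b \<Longrightarrow> w \<in> cbox a b \<Longrightarrow> \<bar>f z - f w\<bar> \<le> L * (\<bar>fst z - fst w\<bar> + \<bar>snd z - snd w\<bar>)"
    and L: "0 \<le> L" and x: "x \<in> cbox a b" and n: "0 < n" and ne: "grid_idx a b n \<noteq> {}"
  shows "\<bar>NN_op \<sigma> a b n f x - f x\<bar> \<le> L / real n * (2 * m) / kappa\<^sup>2"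
proof -
  let ?A = "{\<lceil>real n * fst a\<rceil>..\<lfloor>real n * fst b\<rfloor>}" and ?B = "{\<lceil>real n * snd a\<rceil>..\<lfloor>real n * snd b\<rfloor>}"
  let ?g = "\<lambda>i. phi \<sigma> (real n * fst x - of_int i)" and ?h = "\<lambda>j. phi \<sigma> (real n * snd x - of_int j)"
  let ?u = "\<lambda>i::int. \<bar>real n * fst x - of_int i\<bar>" and ?v = "\<lambda>j::int. \<bar>real n * snd x - of_int j\<bar>"
  have "(\<Sum>k\<in>grid_idx a b n. \<bar>f (real_pair k /\<^sub>R real n) - f x\<bar> * Psi \<sigma> (real n *\<^sub>R x - real_pair k))
    \<le> (\<Sum>k\<in>grid_idx a b n. L / real n * (?u (fst k) + ?v (snd k)) * (?g (fst k) * ?h (snd k)))"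
  proof (rule sum_mono)
    fix k assume k: "k \<in> grid_idx a b n"
    have scale: "\<bar>of_int i / real n - s\<bar> = \<bar>real n * s - of_int i\<bar> / real n" for i :: int and s
      using n by (simp add: field_simps abs_minus_commute abs_divide[symmetric])
    have "\<bar>f (real_pair k /\<^sub>R real n) - f x\<bar> \<le> L * (\<bar>of_int (fst k) / real n - fst x\<bar> + \<bar>of_int (snd k) / real n - snd x\<bar>)"
      using lip[OF sample_point_in_box[OF n k] x] by (simp add: sample_point)
    also have "\<dots> = L / real n * (?u (fst k) + ?v (snd k))"
      unfolding scale by (simp add: add_divide_distrib[symmetric])
    finally show "\<bar>f (real_pair k /\<^sub>R real n) - f x\<bar> * Psi \<sigma> (real n *\<^sub>R x - real_pair k) \<le>
       L / real n * (?u (fst k) + ?v (snd k)) * (?g (fst k) * ?h (snd k))"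
      unfolding Psi_grid by (intro mult_right_mono mult_nonneg_nonneg phi_nonneg)
  qed
  also have "\<dots> = L / real n * ((\<Sum>i\<in>?A. ?u i * ?g i) * (\<Sum>j\<in>?B. ?h j) + (\<Sum>i\<in>?A. ?g i) * (\<Sum>j\<in>?B. ?v j * ?h j))"
    by (subst sum_product_weights[symmetric]) (simp_all add: grid_idx_def sum_distrib_left mult.assoc)
  also have "\<dots> \<le> L / real n * (m * 1 + 1 * m)"
    using L n m[of "{}"] by (intro mult_left_mono add_mono mult_mono m sum_phi_le_1 sum_nonneg mult_nonneg_nonneg phi_nonneg) auto
  finally show ?thesis
    using NN_op_error_le[OF x n ne, of f "f x"] by (smt (verit) divide_right_mono zero_le_power2)
qed

text \<open>The pointwise error is of order \<open>M\<^sup>1\<^sup>/\<^sup>p/n\<close>, and \<open>\<beta>\<^sup>1\<^sup>/\<^sup>p \<bar>I\<bar>\<^sup>1\<^sup>/\<^sup>p\<close> is at most the norm of a partial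
  derivative of \<open>g\<close>; the quotient of the two gradient bounds is the price of combining these facts.
  Without nodes the operator vanishes and the error is the norm of \<open>g\<close>. This happens only for
  \<open>n \<le> N\<close>, so adding \<open>N\<close> to the constant covers it.\<close>
lemma C1_estimate_exists:
  assumes p: "1 \<le> p" and ab: "fst a < fst b" "snd a < snd b"
  shows "\<exists>K1>0. C1_estimate \<sigma> a b p K1"
proof -
  obtain m where m: "0 < m" "\<And>u K. finite K \<Longrightarrow> (\<Sum>k\<in>K. \<bar>u - of_int k\<bar> * phi \<sigma> (u - of_int k)) \<le> m"
    by (rule discrete_moment) blast
  define N where "N = 1 / (fst b - fst a) + 1 / (snd b - snd a)"
  define C where "C = 2 * m / kappa\<^sup>2"
  have C: "0 < C" using m kappa_pos by (simp add: C_def)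
  have N: "0 < N" unfolding N_def using ab by (intro add_pos_pos) auto
  have "C1_estimate \<sigma> a b p (C + N)"
    unfolding C1_estimate_def
  proof (intro allI impI, elim conjE)
    fix g M \<beta> and n :: nat
    assume g: "C1_on (cbox a b) g" and M: "0 < M" and \<beta>: "0 < \<beta>" and n: "0 < n"
      and bnd: "\<forall>x\<in>cbox a b. \<forall>e\<in>Basis. \<bar>partial_deriv (cbox a b) g e x\<bar> powr p \<le> M \<and>
         \<beta> \<le> \<bar>partial_deriv (cbox a b) g e x\<bar> powr p"
    define R where "R = (M / \<beta>) powr (1 / p)"
    have "a \<in> cbox a b" using ab by (simp add: mem_cbox_real_pair)
    hence "\<beta> \<le> M" using bnd by (force simp: Basis_real_pair)
    hence R: "1 \<le> R" unfolding R_def using \<beta> p by (intro ge_one_powr_ge_zero) auto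
    have W0: "0 \<le> W1p_norm p (cbox a b) g" by (rule W1p_norm_nonneg)
    show "Lp_norm p (cbox a b) (\<lambda>x. NN_op \<sigma> a b n g x - g x)
       \<le> (C + N) / real n * (M / \<beta>) powr (1 / p) * W1p_norm p (cbox a b) g"
    proof (cases "grid_idx a b n = {}")
      case True
      have "Lp_norm p (cbox a b) (\<lambda>x. NN_op \<sigma> a b n g x - g x) = Lp_norm p (cbox a b) g"
        using True by (simp add: NN_op_def Lp_norm_def)
      also have "\<dots> \<le> W1p_norm p (cbox a b) g"
        by (simp add: W1p_norm_def Lp_norm_nonneg sum_nonneg)
      also have "\<dots> = 1 * 1 * W1p_norm p (cbox a b) g" by simp
      also have "\<dots> \<le> (C + N) / real n * R * W1p_norm p (cbox a b) g"
      proof (intro mult_right_mono mult_mono R W0)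
        have "real n \<le> N" unfolding N_def by (rule grid_idx_empty_bound[OF True ab])
        thus "1 \<le> (C + N) / real n" using C n by simp
      qed (use C N in auto)
      finally show ?thesis by (simp add: R_def)
    next
      case False
      define L where "L = M powr (1 / p)"
      have Lb: "\<bar>partial_deriv (cbox a b) g e z\<bar> \<le> L" if "z \<in> cbox a b" "e \<in> Basis" for z e
        unfolding L_def using bnd that p by (intro abs_le_powr_inverse) auto
      have box: "cbox a b = {fst a..fst b} \<times> {snd a..snd b}" by (auto simp: mem_cbox_real_pair)
      have lip: "\<bar>g z - g w\<bar> \<le> L * (\<bar>fst z - fst w\<bar> + \<bar>snd z - snd w\<bar>)"
        if "z \<in> cbox a b" "w \<in> cbox a b" for z w
        using C1_on_rectangle_lipschitz[of "{fst a..fst b}" "{snd a..snd b}" g L "fst z" "snd z" "fst w" "snd w"]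
          g Lb that unfolding box by simp
      have "Lp_norm p (cbox a b) (\<lambda>x. NN_op \<sigma> a b n g x - g x) \<le>
          (L / real n * (2 * m) / kappa\<^sup>2) * measure lebesgue (cbox a b) powr (1 / p)"
        using m by (intro Lp_norm_le_sup p NN_op_lipschitz_error[OF m(2) lip _ _ n False]) (auto simp: L_def)
      also have "\<dots> = C / real n * R * (\<beta> powr (1 / p) * measure lebesgue (cbox a b) powr (1 / p))"
        using M \<beta> by (simp add: C_def L_def R_def powr_divide mult_ac)
      also have "\<dots> \<le> C / real n * R * Lp_norm p (cbox a b) (partial_deriv (cbox a b) g (1, 0))"
        using C R g bnd p \<beta> by (intro mult_left_mono Lp_norm_ge_inf) (auto simp: C1_on_def Basis_real_pair)
      also have "\<dots> \<le> C / real n * R * W1p_norm p (cbox a b) g"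
        using C R by (intro mult_left_mono) (auto simp: W1p_norm_def Basis_real_pair Lp_norm_nonneg)
      also have "\<dots> \<le> (C + N) / real n * R * W1p_norm p (cbox a b) g"
        using R N W0 by (intro mult_right_mono divide_right_mono) auto
      finally show ?thesis by (simp add: R_def)
    qed
  qed
  thus ?thesis using C N by (intro exI[of _ "C + N"]) auto
qed

end

section \<open>The mean error for piecewise monotone functions\<close>

text \<open>The sense of monotonicity may change from one line to a parallel one. Continuity is included
  because it makes \<open>f\<close> Borel measurable on the open cells.\<close>
definition coordinatewise_monotone_on :: "real set \<Rightarrow> real set \<Rightarrow> (real \<times> real \<Rightarrow> real) \<Rightarrow> bool" where
  "coordinatewise_monotone_on A B f \<longleftrightarrow>
     (\<forall>v\<in>B. mono_on A (\<lambda>s. f (s, v)) \<or> mono_on A (\<lambda>s. - f (s, v))) \<and>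
     (\<forall>u\<in>A. mono_on B (\<lambda>s. f (u, s)) \<or> mono_on B (\<lambda>s. - f (u, s))) \<and>
     continuous_on (A \<times> B) f"

lemma AE_off_coordinate_lines:
  fixes P Q :: "real set"
  assumes "finite P" "finite Q"
  shows "AE x in (lebesgue :: (real \<times> real) measure). fst x \<notin> P \<and> snd x \<notin> Q"
proof -
  have line: "AE x in (lebesgue :: (real \<times> real) measure). x \<bullet> e \<noteq> c" if "e \<in> Basis" for e :: "real \<times> real" and c
  proof -
    have "{x. x \<bullet> e = c} \<in> null_sets lebesgue"
      using negligible_standard_hyperplane[OF that, of c] by (simp add: negligible_iff_null_sets)
    from AE_not_in[OF this] show ?thesis by simp
  qed
  have "AE x in (lebesgue :: (real \<times> real) measure). \<forall>c\<in>P. x \<bullet> (1, 0) \<noteq> c"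
    using assms by (intro AE_finite_allI line) (auto simp: Basis_real_pair)
  moreover have "AE x in (lebesgue :: (real \<times> real) measure). \<forall>c\<in>Q. x \<bullet> (0, 1) \<noteq> c"
    using assms by (intro AE_finite_allI line) (auto simp: Basis_real_pair)
  ultimately show ?thesis by eventually_elim auto
qed

lemma nn_integral_lborel_pair:
  fixes F :: "real \<times> real \<Rightarrow> ennreal"
  assumes "F \<in> borel_measurable borel"
  shows "(\<integral>\<^sup>+x. F x \<partial>lborel) = (\<integral>\<^sup>+u. \<integral>\<^sup>+v. F (u, v) \<partial>lborel \<partial>lborel)"
  using lborel.nn_integral_fst[of F lborel] assms by (simp add: lborel_prod)

context decaying_sigmoid
begin

text \<open>The value at a node \<open>(i/n, j/n)\<close> is compared with the value at \<open>(u, v)\<close> through the point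
  \<open>(u, j/n)\<close>. On the horizontal leg the increments of \<open>f\<close> are dominated by those of a monotone
  function that depends on the row \<open>j\<close> alone; this gives \<open>h1\<close>, a sum of products of functions of \<open>u\<close> and of \<open>v\<close>. The vertical leg gives \<open>h2\<close>,
  which is estimated for fixed \<open>u\<close>. Rows that run along a grid line carry arbitrary values of \<open>f\<close>;
  there are at most \<open>q2 + 1\<close> of them, each with kernel mass of order \<open>1/n\<close>, and they make up \<open>h3\<close>.\<close>
lemma piecewise_monotone_L1_majorant:
  fixes f :: "real \<times> real \<Rightarrow> real" and n :: nat
  assumes W: "(\<integral>\<^sup>+u. ennreal ((\<bar>u\<bar> + 1) * phi \<sigma> u) \<partial>lborel) \<le> ennreal W" "0 < W"
    and l: "subdivision (fst a) (fst b) q1 l" and t: "subdivision (snd a) (snd b) q2 t"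
    and ab: "fst a < fst b" "snd a < snd b"
    and B: "\<And>x. x \<in> cbox a b \<Longrightarrow> \<bar>f x\<bar> \<le> B"
    and cells: "\<And>i j. i < q1 \<Longrightarrow> j < q2 \<Longrightarrow>
       coordinatewise_monotone_on {l i<..<l (Suc i)} {t j<..<t (Suc j)} f"
    and n: "0 < n"
  obtains h where "h \<in> borel_measurable borel" "\<And>x. 0 \<le> h x"
    "AE x in lebesgue. x \<in> cbox a b \<longrightarrow>
       (\<Sum>k\<in>grid_idx a b n. \<bar>f (real_pair k /\<^sub>R real n) - f x\<bar> * Psi \<sigma> (real n *\<^sub>R x - real_pair k)) \<le> h x"
    "(\<integral>\<^sup>+x. ennreal (h x) * indicator (cbox a b) x \<partial>lborel) \<le>
       ennreal (B * real q1 * real q2 / real n * (W * (8 * (snd b - snd a) + 12 * (fst b - fst a))))"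
proof -
  have mono1: "mono_on {l i<..<l (Suc i)} (\<lambda>s. f (s, v)) \<or> mono_on {l i<..<l (Suc i)} (\<lambda>s. - f (s, v))"
    if "i < q1" "j < q2" "v \<in> {t j<..<t (Suc j)}" for i j v
    using cells[OF that(1,2)] that(3) unfolding coordinatewise_monotone_on_def by blast
  have mono2: "mono_on {t j<..<t (Suc j)} (\<lambda>s. f (u, s)) \<or> mono_on {t j<..<t (Suc j)} (\<lambda>s. - f (u, s))"
    if "i < q1" "j < q2" "u \<in> {l i<..<l (Suc i)}" for i j u
    using cells[OF that(1,2)] that(3) unfolding coordinatewise_monotone_on_def by blast
  have cont: "continuous_on ({l i<..<l (Suc i)} \<times> {t j<..<t (Suc j)}) f" if "i < q1" "j < q2" for i j
    using cells[OF that] unfolding coordinatewise_monotone_on_def by blast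
  define A1 where "A1 = {\<lceil>real n * fst a\<rceil>..\<lfloor>real n * fst b\<rfloor>}"
  define A2 where "A2 = {\<lceil>real n * snd a\<rceil>..\<lfloor>real n * snd b\<rfloor>}"
  have fin [simp]: "finite A1" "finite A2" by (simp_all add: A1_def A2_def)
  have grid: "grid_idx a b n = A1 \<times> A2" by (simp add: grid_idx_def A1_def A2_def)
  have A1: "of_int i / real n \<in> {fst a..fst b}" if "i \<in> A1" for i
    using that n by (auto simp: A1_def field_simps le_floor_iff ceiling_le_iff)
  have A2: "of_int j / real n \<in> {snd a..snd b}" if "j \<in> A2" for j
    using that n by (auto simp: A2_def field_simps le_floor_iff ceiling_le_iff)
  have "a \<in> cbox a b" using ab by (simp add: mem_cbox_real_pair)
  hence B0: "0 \<le> B" using B by fastforce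
  have q: "1 \<le> q1" "1 \<le> q2" using l t ab by (auto simp: subdivision_def Suc_le_eq intro!: gr0I)
  define L1 where "L1 = l ` {..q1}"
  define L2 where "L2 = t ` {..q2}"
  have finL: "finite L1" "finite L2" by (simp_all add: L1_def L2_def)
  \<comment> \<open>Indices \<open>j\<close> are bad if the row \<open>v = j/n\<close> lies on a grid line.\<close>
  define good where "good = {j \<in> A2. of_int j / real n \<notin> L2}"
  define bad where "bad = {j \<in> A2. of_int j / real n \<in> L2}"
  have gb: "finite good" "finite bad" "A2 = good \<union> bad" "good \<inter> bad = {}"
    by (auto simp: good_def bad_def)
  have card_bad: "card bad \<le> q2 + 1"
  proof -
    have "card bad \<le> card L2"
      using n finL by (intro card_inj_on_le[of "\<lambda>j. of_int j / real n"]) (auto simp: inj_on_def bad_def)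
    also have "\<dots> \<le> q2 + 1" unfolding L2_def using card_image_le[of "{..q2}" t] by simp
    finally show ?thesis .
  qed
  define cells where "cells = (\<Union>i<q1. \<Union>j<q2. {l i<..<l (Suc i)} \<times> {t j<..<t (Suc j)})"
  have in_cells: "(u, v) \<in> cells" if uv: "u \<in> {fst a..fst b} - L1" "v \<in> {snd a..snd b} - L2" for u v
  proof -
    obtain i where "i < q1" "u \<in> {l i<..<l (Suc i)}"
      using subdivision_locate_open[OF l, of u] uv by (auto simp: L1_def)
    moreover obtain j where "j < q2" "v \<in> {t j<..<t (Suc j)}"
      using subdivision_locate_open[OF t, of v] uv by (auto simp: L2_def)
    ultimately show ?thesis unfolding cells_def by blast
  qed
  \<comment> \<open>A Borel function that agrees with \<open>f\<close> off the grid lines.\<close>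
  define fc where "fc x = (if x \<in> cells then f x else 0)" for x
  have "open cells" unfolding cells_def by (intro open_UN ballI open_Times) auto
  moreover have "continuous_on cells f"
    unfolding cells_def by (intro continuous_on_open_UN cont open_UN ballI open_Times) auto
  ultimately have fc_meas [measurable]: "fc \<in> borel_measurable borel"
    unfolding fc_def[abs_def] by (intro borel_measurable_continuous_on_if) auto

  have "\<exists>G. mono G \<and> (\<forall>x. 0 \<le> G x) \<and> (\<forall>x. G x \<le> 8 * B * real q1) \<and>
      (\<forall>x\<in>{fst a..fst b}. \<forall>y\<in>{fst a..fst b}. \<bar>f (x, v) - f (y, v)\<bar> \<le> \<bar>G x - G y\<bar>)"
    if v: "v \<in> {snd a..snd b} - L2" for v
  proof -
    obtain j where j: "j < q2" "v \<in> {t j<..<t (Suc j)}"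
      using subdivision_locate_open[OF t, of v] v by (auto simp: L2_def)
    show ?thesis
      using piecewise_monotone_dominated[OF l, of "\<lambda>s. f (s, v)" B] mono1[OF _ j] B v
      by (smt (verit, best) mem_cbox_real_pair fst_conv snd_conv DiffD1)
  qed
  then obtain G where G: "\<And>v. v \<in> {snd a..snd b} - L2 \<Longrightarrow> mono (G v) \<and> (\<forall>x. 0 \<le> G v x) \<and>
      (\<forall>x. G v x \<le> 8 * B * real q1) \<and>
      (\<forall>x\<in>{fst a..fst b}. \<forall>y\<in>{fst a..fst b}. \<bar>f (x, v) - f (y, v)\<bar> \<le> \<bar>G v x - G v y\<bar>)"
    by metis
  have "\<exists>G. mono G \<and> (\<forall>x. 0 \<le> G x) \<and> (\<forall>x. G x \<le> 8 * B * real q2) \<and>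
      (\<forall>x\<in>{snd a..snd b}. \<forall>y\<in>{snd a..snd b}. \<bar>f (u, x) - f (u, y)\<bar> \<le> \<bar>G x - G y\<bar>)"
    if u: "u \<in> {fst a..fst b} - L1" for u
  proof -
    obtain i where i: "i < q1" "u \<in> {l i<..<l (Suc i)}"
      using subdivision_locate_open[OF l, of u] u by (auto simp: L1_def)
    show ?thesis
      using piecewise_monotone_dominated[OF t, of "\<lambda>s. f (u, s)" B] mono2[OF i(1) _ i(2)] B u
      by (smt (verit, best) mem_cbox_real_pair fst_conv snd_conv DiffD1)
  qed
  then obtain G' where G': "\<And>u. u \<in> {fst a..fst b} - L1 \<Longrightarrow> mono (G' u) \<and> (\<forall>x. 0 \<le> G' u x) \<and>
      (\<forall>x. G' u x \<le> 8 * B * real q2) \<and>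
      (\<forall>x\<in>{snd a..snd b}. \<forall>y\<in>{snd a..snd b}. \<bar>f (u, x) - f (u, y)\<bar> \<le> \<bar>G' u x - G' u y\<bar>)"
    by metis

  define \<xi> where "\<xi> j = real_of_int j / real n" for j
  have \<xi>_good: "\<xi> j \<in> {snd a..snd b} - L2" if "j \<in> good" for j
    using that A2 by (auto simp: good_def \<xi>_def)
  define S where "S j u = (\<Sum>i\<in>A1. \<bar>G (\<xi> j) (of_int i / real n) - G (\<xi> j) u\<bar> * phi \<sigma> (real n * u - of_int i))" for j u
  have S0: "0 \<le> S j u" for j u unfolding S_def by (intro sum_nonneg mult_nonneg_nonneg phi_nonneg) auto
  have S_meas [measurable]: "S j \<in> borel_measurable borel" if "j \<in> good" for j
  proof -
    have [measurable]: "G (\<xi> j) \<in> borel_measurable borel"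
      using G[OF \<xi>_good[OF that]] by (intro borel_measurable_mono) simp
    show ?thesis unfolding S_def[abs_def] by measurable
  qed
  let ?w = "\<lambda>j v. phi \<sigma> (real n * v - of_int j)"
  define h1 where "h1 x = (\<Sum>j\<in>good. S j (fst x) * ?w j (snd x))" for x
  define h2 where "h2 x = (\<Sum>j\<in>good. \<bar>fc (fst x, \<xi> j) - fc x\<bar> * ?w j (snd x))" for x
  define h3 where "h3 x = (\<Sum>j\<in>bad. 2 * B * ?w j (snd x))" for x :: "real \<times> real"
  have h_nonneg: "0 \<le> h1 x" "0 \<le> h2 x" "0 \<le> h3 x" for x
    unfolding h1_def h2_def h3_def using B0 by (auto intro!: sum_nonneg mult_nonneg_nonneg S0 phi_nonneg)
  have h1_meas [measurable]: "h1 \<in> borel_measurable borel"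
    unfolding h1_def[abs_def] borel_prod[symmetric] by (intro borel_measurable_sum) measurable
  have h2_meas [measurable]: "h2 \<in> borel_measurable borel"
    using fc_meas unfolding h2_def[abs_def] borel_prod[symmetric] by measurable
  have h3_meas [measurable]: "h3 \<in> borel_measurable borel"
    unfolding h3_def[abs_def] borel_prod[symmetric] by measurable

  have pointwise: "(\<Sum>k\<in>grid_idx a b n. \<bar>f (real_pair k /\<^sub>R real n) - f x\<bar> * Psi \<sigma> (real n *\<^sub>R x - real_pair k))
      \<le> h1 x + h2 x + h3 x" if x: "x \<in> cbox a b" "fst x \<notin> L1" "snd x \<notin> L2" for x
  proof -
    obtain u v where uv: "x = (u, v)" by (cases x)
    have u: "u \<in> {fst a..fst b} - L1" and v: "v \<in> {snd a..snd b} - L2"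
      using x by (auto simp: uv mem_cbox_real_pair)
    let ?g = "\<lambda>i. phi \<sigma> (real n * u - of_int i)"
    have g1: "(\<Sum>i\<in>A1. ?g i) \<le> 1" by (rule sum_phi_le_1) simp
    have row: "(\<Sum>i\<in>A1. \<bar>f (of_int i / real n, \<xi> j) - f x\<bar> * ?g i) \<le>
        (if j \<in> good then S j u + \<bar>fc (u, \<xi> j) - fc x\<bar> else 2 * B)" if j: "j \<in> A2" for j
    proof (cases "j \<in> good")
      case True
      have fc: "fc (u, \<xi> j) = f (u, \<xi> j)" "fc x = f x"
        using in_cells[OF u \<xi>_good[OF True]] in_cells[OF u v] by (simp_all add: fc_def uv)
      have "(\<Sum>i\<in>A1. \<bar>f (of_int i / real n, \<xi> j) - f x\<bar> * ?g i) \<le>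
         (\<Sum>i\<in>A1. (\<bar>G (\<xi> j) (of_int i / real n) - G (\<xi> j) u\<bar> + \<bar>fc (u, \<xi> j) - fc x\<bar>) * ?g i)"
      proof (intro sum_mono mult_right_mono phi_nonneg)
        fix i assume "i \<in> A1"
        hence "\<bar>f (of_int i / real n, \<xi> j) - f (u, \<xi> j)\<bar> \<le> \<bar>G (\<xi> j) (of_int i / real n) - G (\<xi> j) u\<bar>"
          using G[OF \<xi>_good[OF True]] A1 u by blast
        thus "\<bar>f (of_int i / real n, \<xi> j) - f x\<bar> \<le>
            \<bar>G (\<xi> j) (of_int i / real n) - G (\<xi> j) u\<bar> + \<bar>fc (u, \<xi> j) - fc x\<bar>"
          unfolding fc by linarith
      qed
      also have "\<dots> = S j u + \<bar>fc (u, \<xi> j) - fc x\<bar> * (\<Sum>i\<in>A1. ?g i)"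
        by (simp add: S_def distrib_right sum.distrib sum_distrib_left)
      also have "\<dots> \<le> S j u + \<bar>fc (u, \<xi> j) - fc x\<bar> * 1"
        by (intro add_left_mono mult_left_mono g1) auto
      finally show ?thesis using True by simp
    next
      case False
      have "(\<Sum>i\<in>A1. \<bar>f (of_int i / real n, \<xi> j) - f x\<bar> * ?g i) \<le> (\<Sum>i\<in>A1. 2 * B * ?g i)"
      proof (intro sum_mono mult_right_mono phi_nonneg)
        fix i assume "i \<in> A1"
        hence "(of_int i / real n, \<xi> j) \<in> cbox a b"
          using A1[of i] A2[OF j] by (simp add: mem_cbox_real_pair \<xi>_def)
        from B[OF this] B[OF x(1)] show "\<bar>f (of_int i / real n, \<xi> j) - f x\<bar> \<le> 2 * B" by linarith
      qed
      also have "\<dots> = 2 * B * (\<Sum>i\<in>A1. ?g i)" by (simp add: sum_distrib_left)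
      also have "\<dots> \<le> 2 * B * 1" using B0 g1 by (intro mult_left_mono) auto
      finally show ?thesis using False by simp
    qed
    have "(\<Sum>k\<in>grid_idx a b n. \<bar>f (real_pair k /\<^sub>R real n) - f x\<bar> * Psi \<sigma> (real n *\<^sub>R x - real_pair k))
        = (\<Sum>i\<in>A1. \<Sum>j\<in>A2. \<bar>f (of_int i / real n, \<xi> j) - f x\<bar> * ?g i * ?w j v)"
      unfolding grid sum.cartesian_product Psi_grid sample_point
      by (intro sum.cong) (auto simp: \<xi>_def uv)
    also have "\<dots> = (\<Sum>j\<in>A2. (\<Sum>i\<in>A1. \<bar>f (of_int i / real n, \<xi> j) - f x\<bar> * ?g i) * ?w j v)"
      by (subst sum.swap) (simp add: sum_distrib_right)
    also have "\<dots> \<le> (\<Sum>j\<in>A2. (if j \<in> good then S j u + \<bar>fc (u, \<xi> j) - fc x\<bar> else 2 * B) * ?w j v)"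
      by (intro sum_mono mult_right_mono row phi_nonneg)
    also have "\<dots> = (\<Sum>j\<in>good. (S j u + \<bar>fc (u, \<xi> j) - fc x\<bar>) * ?w j v) + (\<Sum>j\<in>bad. 2 * B * ?w j v)"
      unfolding gb(3) sum.union_disjoint[OF gb(1,2,4)]
      by (intro arg_cong2[of _ _ _ _ "(+)"] sum.cong) (use gb(4) in auto)
    also have "\<dots> = h1 x + h2 x + h3 x"
      by (simp add: h1_def h2_def h3_def uv distrib_right sum.distrib)
    finally show ?thesis .
  qed

  let ?I1 = "\<lambda>u. indicator {fst a..fst b} u :: ennreal"
  let ?I2 = "\<lambda>v. indicator {snd a..snd b} v :: ennreal"
  have box: "indicator (cbox a b) (u, v) = ?I1 u * ?I2 v" for u v
    by (simp add: indicator_def mem_cbox_real_pair)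
  have box_meas [measurable]: "(\<lambda>x. indicator (cbox a b) x :: ennreal) \<in> borel_measurable borel"
    by measurable
  have V: "0 \<le> 8 * B * real q1" "0 \<le> 8 * B * real q2" using B0 by auto

  have int1: "(\<integral>\<^sup>+x. ennreal (h1 x) * indicator (cbox a b) x \<partial>lborel) \<le>
      ennreal (8 * B * real q1 * W / real n * (snd b - snd a))"
  proof -
    have "(\<integral>\<^sup>+x. ennreal (h1 x) * indicator (cbox a b) x \<partial>lborel) =
        (\<integral>\<^sup>+u. \<integral>\<^sup>+v. ennreal (h1 (u, v)) * indicator (cbox a b) (u, v) \<partial>lborel \<partial>lborel)"
      by (rule nn_integral_lborel_pair) measurable
    also have "\<dots> \<le> (\<integral>\<^sup>+u. (\<Sum>j\<in>good. ennreal (S j u) * (\<integral>\<^sup>+v. ennreal (?w j v) * ?I2 v \<partial>lborel)) \<partial>lborel)"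
    proof (rule nn_integral_mono)
      fix u
      have "(\<integral>\<^sup>+v. ennreal (h1 (u, v)) * indicator (cbox a b) (u, v) \<partial>lborel) \<le>
          (\<integral>\<^sup>+v. (\<Sum>j\<in>good. ennreal (S j u) * (ennreal (?w j v) * ?I2 v)) \<partial>lborel)"
        unfolding box by (intro nn_integral_mono)
          (auto simp: h1_def indicator_def sum_ennreal[symmetric] S0 phi_nonneg ennreal_mult)
      also have "\<dots> = (\<Sum>j\<in>good. \<integral>\<^sup>+v. ennreal (S j u) * (ennreal (?w j v) * ?I2 v) \<partial>lborel)"
        by (intro nn_integral_sum) measurable
      also have "\<dots> = (\<Sum>j\<in>good. ennreal (S j u) * (\<integral>\<^sup>+v. ennreal (?w j v) * ?I2 v \<partial>lborel))"
        by (intro sum.cong refl nn_integral_cmult) measurable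
      finally show "(\<integral>\<^sup>+v. ennreal (h1 (u, v)) * indicator (cbox a b) (u, v) \<partial>lborel) \<le> \<dots>" .
    qed
    also have "\<dots> = (\<Sum>j\<in>good. \<integral>\<^sup>+u. ennreal (S j u) * (\<integral>\<^sup>+v. ennreal (?w j v) * ?I2 v \<partial>lborel) \<partial>lborel)"
      by (intro nn_integral_sum) measurable
    also have "\<dots> = (\<Sum>j\<in>good. (\<integral>\<^sup>+u. ennreal (S j u) \<partial>lborel) * (\<integral>\<^sup>+v. ennreal (?w j v) * ?I2 v \<partial>lborel))"
      by (intro sum.cong refl nn_integral_multc) measurable
    also have "\<dots> \<le> (\<Sum>j\<in>good. ennreal (8 * B * real q1 * W / real n) * (\<integral>\<^sup>+v. ennreal (?w j v) * ?I2 v \<partial>lborel))"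
    proof (intro sum_mono mult_right_mono)
      fix j assume "j \<in> good"
      from G[OF \<xi>_good[OF this]] show "(\<integral>\<^sup>+u. ennreal (S j u) \<partial>lborel) \<le> ennreal (8 * B * real q1 * W / real n)"
        unfolding S_def using n by (intro monotone_sampling_integral W) auto
    qed auto
    also have "\<dots> = ennreal (8 * B * real q1 * W / real n) * (\<integral>\<^sup>+v. (\<Sum>j\<in>good. ennreal (?w j v) * ?I2 v) \<partial>lborel)"
      unfolding sum_distrib_left[symmetric] by (subst nn_integral_sum) auto
    also have "\<dots> \<le> ennreal (8 * B * real q1 * W / real n) * (\<integral>\<^sup>+v. ?I2 v \<partial>lborel)"
    proof (intro mult_left_mono nn_integral_mono)
      fix v
      have "(\<Sum>j\<in>good. ennreal (?w j v)) \<le> 1"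
        using sum_phi_le_1[OF gb(1), of "real n * v"] by (simp add: sum_ennreal phi_nonneg)
      thus "(\<Sum>j\<in>good. ennreal (?w j v) * ?I2 v) \<le> ?I2 v"
        by (auto simp: indicator_def)
    qed auto
    also have "\<dots> = ennreal (8 * B * real q1 * W / real n * (snd b - snd a))"
      using ab V W n by (simp add: ennreal_mult'[symmetric] mult_nonneg_nonneg)
    finally show ?thesis .
  qed

  have int2: "(\<integral>\<^sup>+x. ennreal (h2 x) * indicator (cbox a b) x \<partial>lborel) \<le>
      ennreal (8 * B * real q2 * W / real n * (fst b - fst a))"
  proof -
    have "(\<integral>\<^sup>+x. ennreal (h2 x) * indicator (cbox a b) x \<partial>lborel) =
        (\<integral>\<^sup>+u. \<integral>\<^sup>+v. ennreal (h2 (u, v)) * indicator (cbox a b) (u, v) \<partial>lborel \<partial>lborel)"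
      by (rule nn_integral_lborel_pair) measurable
    also have "\<dots> \<le> (\<integral>\<^sup>+u. ennreal (8 * B * real q2 * W / real n) * ?I1 u \<partial>lborel)"
    proof (rule nn_integral_mono_AE)
      have "AE u in lborel. u \<notin> L1"
        by (intro AE_not_in finite_imp_null_set_lborel finL)
      thus "AE u in lborel. (\<integral>\<^sup>+v. ennreal (h2 (u, v)) * indicator (cbox a b) (u, v) \<partial>lborel) \<le>
          ennreal (8 * B * real q2 * W / real n) * ?I1 u"
      proof eventually_elim
        case (elim u)
        show ?case
        proof (cases "u \<in> {fst a..fst b}")
          case True
          with elim have u: "u \<in> {fst a..fst b} - L1" by simp
          have "(\<integral>\<^sup>+v. ennreal (h2 (u, v)) * indicator (cbox a b) (u, v) \<partial>lborel) \<le>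
             (\<integral>\<^sup>+v. ennreal (\<Sum>j\<in>good. \<bar>G' u (of_int j / real n) - G' u v\<bar> * ?w j v) \<partial>lborel)"
          proof (rule nn_integral_mono_AE)
            have "AE v in lborel. v \<notin> L2"
              by (intro AE_not_in finite_imp_null_set_lborel finL)
            thus "AE v in lborel. ennreal (h2 (u, v)) * indicator (cbox a b) (u, v) \<le>
                ennreal (\<Sum>j\<in>good. \<bar>G' u (of_int j / real n) - G' u v\<bar> * ?w j v)"
            proof eventually_elim
              case (elim v)
              show ?case
              proof (cases "v \<in> {snd a..snd b}")
                case True
                with elim have v: "v \<in> {snd a..snd b} - L2" by simp
                have "h2 (u, v) \<le> (\<Sum>j\<in>good. \<bar>G' u (of_int j / real n) - G' u v\<bar> * ?w j v)"
                  unfolding h2_def fst_conv snd_conv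
                proof (intro sum_mono mult_right_mono phi_nonneg)
                  fix j assume j: "j \<in> good"
                  have "fc (u, \<xi> j) = f (u, \<xi> j)" "fc (u, v) = f (u, v)"
                    using in_cells[OF u \<xi>_good[OF j]] in_cells[OF u v] by (simp_all add: fc_def)
                  thus "\<bar>fc (u, \<xi> j) - fc (u, v)\<bar> \<le> \<bar>G' u (of_int j / real n) - G' u v\<bar>"
                    using G'[OF u] \<xi>_good[OF j] v by (auto simp: \<xi>_def)
                qed
                thus ?thesis by (auto simp: indicator_def intro: ennreal_leI)
              qed (simp add: box)
            qed
          qed
          also have "\<dots> \<le> ennreal (8 * B * real q2 * W / real n)"
            using G'[OF u] n gb by (intro monotone_sampling_integral W) auto
          finally show ?thesis using True by simp
        qed (simp add: box)
      qed
    qed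
    also have "\<dots> = ennreal (8 * B * real q2 * W / real n * (fst b - fst a))"
      using ab V W n by (subst nn_integral_cmult) (auto simp: ennreal_mult'[symmetric])
    finally show ?thesis .
  qed

  have int3: "(\<integral>\<^sup>+x. ennreal (h3 x) * indicator (cbox a b) x \<partial>lborel) \<le>
      ennreal (4 * B * real q2 * W / real n * (fst b - fst a))"
  proof -
    have "(\<integral>\<^sup>+x. ennreal (h3 x) * indicator (cbox a b) x \<partial>lborel) =
        (\<integral>\<^sup>+u. \<integral>\<^sup>+v. ennreal (h3 (u, v)) * indicator (cbox a b) (u, v) \<partial>lborel \<partial>lborel)"
      by (rule nn_integral_lborel_pair) measurable
    also have "\<dots> \<le> (\<integral>\<^sup>+u. ennreal (4 * B * real q2 * W / real n) * ?I1 u \<partial>lborel)"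
    proof (rule nn_integral_mono)
      fix u
      have "(\<integral>\<^sup>+v. ennreal (h3 (u, v)) * indicator (cbox a b) (u, v) \<partial>lborel) \<le>
          (\<integral>\<^sup>+v. (\<Sum>j\<in>bad. ennreal (2 * B) * ennreal (?w j v)) * ?I1 u \<partial>lborel)"
        unfolding box using B0 by (intro nn_integral_mono)
          (auto simp: h3_def indicator_def sum_ennreal[symmetric] phi_nonneg ennreal_mult)
      also have "\<dots> = (\<integral>\<^sup>+v. (\<Sum>j\<in>bad. ennreal (2 * B) * ennreal (?w j v)) \<partial>lborel) * ?I1 u"
        by (rule nn_integral_multc) measurable
      also have "(\<integral>\<^sup>+v. (\<Sum>j\<in>bad. ennreal (2 * B) * ennreal (?w j v)) \<partial>lborel) =
          (\<Sum>j\<in>bad. ennreal (2 * B) * (\<integral>\<^sup>+v. ennreal (?w j v) \<partial>lborel))"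
        by (subst nn_integral_sum) (auto intro!: sum.cong nn_integral_cmult)
      also have "\<dots> \<le> (\<Sum>j\<in>bad. ennreal (2 * B) * ennreal (W / real n))"
        using n by (intro sum_mono mult_left_mono phi_scaled_integral W) auto
      also have "\<dots> = ennreal (real (card bad) * (2 * B * (W / real n)))"
        using B0 W n by (simp add: ennreal_mult'[symmetric] ennreal_of_nat_eq_real_of_nat)
      also have "\<dots> \<le> ennreal (4 * B * real q2 * W / real n)"
      proof (rule ennreal_leI)
        have "real (card bad) * (2 * B * (W / real n)) \<le> (2 * real q2) * (2 * B * (W / real n))"
          using card_bad q B0 W n by (intro mult_right_mono) auto
        thus "real (card bad) * (2 * B * (W / real n)) \<le> 4 * B * real q2 * W / real n"
          by (simp add: mult_ac)
      qed
      finally show "(\<integral>\<^sup>+v. ennreal (h3 (u, v)) * indicator (cbox a b) (u, v) \<partial>lborel) \<le>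
          ennreal (4 * B * real q2 * W / real n) * ?I1 u"
        by (simp add: mult_right_mono)
    qed
    also have "\<dots> = ennreal (4 * B * real q2 * W / real n * (fst b - fst a))"
      using ab V W n B0 by (subst nn_integral_cmult) (auto simp: ennreal_mult'[symmetric])
    finally show ?thesis .
  qed

  show ?thesis
  proof (rule that[of "\<lambda>x. h1 x + h2 x + h3 x"])
    show "(\<lambda>x. h1 x + h2 x + h3 x) \<in> borel_measurable borel" by measurable
    show "0 \<le> h1 x + h2 x + h3 x" for x using h_nonneg[of x] by simp
    show "AE x in lebesgue. x \<in> cbox a b \<longrightarrow>
       (\<Sum>k\<in>grid_idx a b n. \<bar>f (real_pair k /\<^sub>R real n) - f x\<bar> * Psi \<sigma> (real n *\<^sub>R x - real_pair k))
         \<le> h1 x + h2 x + h3 x"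
      using AE_off_coordinate_lines[OF finL] by eventually_elim (use pointwise in auto)
    have add12: "(\<integral>\<^sup>+x. ennreal (h1 x) * indicator (cbox a b) x + ennreal (h2 x) * indicator (cbox a b) x \<partial>lborel) =
        (\<integral>\<^sup>+x. ennreal (h1 x) * indicator (cbox a b) x \<partial>lborel) +
        (\<integral>\<^sup>+x. ennreal (h2 x) * indicator (cbox a b) x \<partial>lborel)"
      by (rule nn_integral_add) measurable
    have "(\<integral>\<^sup>+x. ennreal (h1 x + h2 x + h3 x) * indicator (cbox a b) x \<partial>lborel) =
       (\<integral>\<^sup>+x. (ennreal (h1 x) * indicator (cbox a b) x + ennreal (h2 x) * indicator (cbox a b) x) +
          ennreal (h3 x) * indicator (cbox a b) x \<partial>lborel)"
      by (intro nn_integral_cong) (simp add: h_nonneg distrib_right)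
    also have "\<dots> = (\<integral>\<^sup>+x. ennreal (h1 x) * indicator (cbox a b) x \<partial>lborel) +
        (\<integral>\<^sup>+x. ennreal (h2 x) * indicator (cbox a b) x \<partial>lborel) +
        (\<integral>\<^sup>+x. ennreal (h3 x) * indicator (cbox a b) x \<partial>lborel)"
      unfolding add12[symmetric] by (rule nn_integral_add) measurable
    also have "\<dots> \<le> ennreal (8 * B * real q1 * W / real n * (snd b - snd a)) +
        ennreal (8 * B * real q2 * W / real n * (fst b - fst a)) +
        ennreal (4 * B * real q2 * W / real n * (fst b - fst a))"
      by (intro add_mono int1 int2 int3)
    also have "\<dots> = ennreal (8 * B * real q1 * W / real n * (snd b - snd a) +
        8 * B * real q2 * W / real n * (fst b - fst a) + 4 * B * real q2 * W / real n * (fst b - fst a))"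
      using ab V W n B0 by (simp add: ennreal_plus[symmetric] del: ennreal_plus)
    also have "\<dots> = ennreal (B * W / real n * (real q1 * (8 * (snd b - snd a)) + real q2 * (12 * (fst b - fst a))))"
      by (rule arg_cong[of _ _ ennreal]) (simp add: divide_inverse algebra_simps)
    also have "\<dots> \<le> ennreal (B * W / real n * ((real q1 * real q2) * (8 * (snd b - snd a)) + (real q1 * real q2) * (12 * (fst b - fst a))))"
      using q ab B0 W by (intro ennreal_leI mult_left_mono add_mono mult_right_mono) auto
    also have "\<dots> = ennreal (B * real q1 * real q2 / real n * (W * (8 * (snd b - snd a) + 12 * (fst b - fst a))))"
      by (rule arg_cong[of _ _ ennreal]) (simp add: divide_inverse algebra_simps)
    finally show "(\<integral>\<^sup>+x. ennreal (h1 x + h2 x + h3 x) * indicator (cbox a b) x \<partial>lborel) \<le> \<dots>" .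
  qed
qed

end

section \<open>Rates of approximation\<close>

context decaying_sigmoid
begin

text \<open>If there are no nodes, then the operator vanishes and the mean error is at most \<open>B\<close> times the area
  of the rectangle. As \<open>n \<le> N\<close> in this case, the summand \<open>area * N\<close> of the constant makes the bound
  of order \<open>1/n\<close> cover it as well.\<close>
lemma piecewise_monotone_rate:
  assumes p: "1 \<le> p" and ab: "fst a < fst b" "snd a < snd b"
  obtains C where "0 < C"
    "\<And>q1 q2 l t (f :: real \<times> real \<Rightarrow> real) B (n::nat).
      subdivision (fst a) (fst b) q1 l \<Longrightarrow> subdivision (snd a) (snd b) q2 t \<Longrightarrow>
      (\<And>x. x \<in> cbox a b \<Longrightarrow> \<bar>f x\<bar> \<le> B) \<Longrightarrow>
      (\<And>i j. i < q1 \<Longrightarrow> j < q2 \<Longrightarrow>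
         coordinatewise_monotone_on {l i<..<l (Suc i)} {t j<..<t (Suc j)} f) \<Longrightarrow>
      0 < n \<Longrightarrow>
      Lp_norm p (cbox a b) (\<lambda>x. NN_op \<sigma> a b n f x - f x) \<le>
        (2 powr (p - 1) * real q1 * real q2) powr (1 / p) * (B * (C / real n) powr (1 / p))"
proof -
  obtain W where W: "0 < W" "(\<integral>\<^sup>+u. ennreal ((\<bar>u\<bar> + 1) * phi \<sigma> u) \<partial>lborel) \<le> ennreal W"
    by (rule integral_moment) blast
  define area where "area = measure lborel (cbox a b)"
  define N where "N = 1 / (fst b - fst a) + 1 / (snd b - snd a)"
  define C1 where "C1 = W * (8 * (snd b - snd a) + 12 * (fst b - fst a)) / kappa\<^sup>2"
  define C where "C = C1 + area * N"
  have N: "0 < N" unfolding N_def using ab by (intro add_pos_pos) auto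
  have C1: "0 < C1" unfolding C1_def using W ab kappa_pos by (intro divide_pos_pos mult_pos_pos add_pos_pos) auto
  have area: "0 \<le> area" by (simp add: area_def)
  have C: "0 < C" using C1 N area by (simp add: C_def add_pos_nonneg)
  show ?thesis
  proof (rule that[OF C])
    fix q1 q2 l t B and f :: "real \<times> real \<Rightarrow> real" and n :: nat
    assume l: "subdivision (fst a) (fst b) q1 l" and t: "subdivision (snd a) (snd b) q2 t"
      and B: "\<And>x. x \<in> cbox a b \<Longrightarrow> \<bar>f x\<bar> \<le> B"
      and cells: "\<And>i j. i < q1 \<Longrightarrow> j < q2 \<Longrightarrow>
         coordinatewise_monotone_on {l i<..<l (Suc i)} {t j<..<t (Suc j)} f"
      and n: "0 < n"
    have "a \<in> cbox a b" using ab by (simp add: mem_cbox_real_pair)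
    hence B0: "0 \<le> B" using B by fastforce
    have "1 \<le> q1" "1 \<le> q2" using l t ab by (auto simp: subdivision_def Suc_le_eq intro!: gr0I)
    hence q: "1 \<le> real q1 * real q2" using mult_mono[of 1 "real q1" 1 "real q2"] by simp
    have two_B: "\<bar>NN_op \<sigma> a b n f x - f x\<bar> \<le> 2 * B" if "x \<in> cbox a b" for x
    proof -
      have "\<bar>NN_op \<sigma> a b n f x\<bar> \<le> B" by (rule NN_op_bounded[OF that n B])
      thus ?thesis using B[OF that] by linarith
    qed
    define D where "D = B * real q1 * real q2 / real n * C"
    have D0: "0 \<le> D" using B0 C by (simp add: D_def)
    have "\<exists>h. h \<in> borel_measurable borel \<and>
        (AE x in lebesgue. x \<in> cbox a b \<longrightarrow> \<bar>NN_op \<sigma> a b n f x - f x\<bar> \<le> h x) \<and>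
        (\<integral>\<^sup>+x. ennreal (h x) * indicator (cbox a b) x \<partial>lborel) \<le> ennreal D"
    proof (cases "grid_idx a b n = {}")
      case True
      have "emeasure lborel (cbox a b) = ennreal area"
        unfolding area_def by (intro emeasure_eq_ennreal_measure) (use emeasure_lborel_cbox_finite[of a b] in auto)
      hence "(\<integral>\<^sup>+x. ennreal B * indicator (cbox a b) x \<partial>lborel) = ennreal (B * area)"
        using B0 by (simp add: nn_integral_cmult ennreal_mult')
      also have "\<dots> \<le> ennreal D"
      proof (rule ennreal_leI)
        have "real n \<le> N" unfolding N_def by (rule grid_idx_empty_bound[OF True ab])
        hence "1 \<le> N / real n" using n by simp
        \<comment> \<open>Only \<open>n \<le> N\<close> can occur here, so a bound without \<open>n\<close> is also one of order \<open>1/n\<close>.\<close>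
        hence "1 * 1 \<le> real q1 * real q2 * (N / real n)" using q by (intro mult_mono) auto
        hence "B * area * 1 \<le> B * area * (real q1 * real q2 * (N / real n))"
          using B0 area by (intro mult_left_mono) auto
        also have "\<dots> = B * real q1 * real q2 / real n * (area * N)" by simp
        also have "\<dots> \<le> D" unfolding D_def C_def using B0 C1 by (intro mult_left_mono) auto
        finally show "B * area \<le> D" by simp
      qed
      finally show ?thesis
        using B True by (intro exI[of _ "\<lambda>x. B"]) (auto simp: NN_op_def)
    next
      case False
      obtain h where h: "h \<in> borel_measurable borel" "\<And>x. 0 \<le> h x"
        "AE x in lebesgue. x \<in> cbox a b \<longrightarrow>
          (\<Sum>k\<in>grid_idx a b n. \<bar>f (real_pair k /\<^sub>R real n) - f x\<bar> * Psi \<sigma> (real n *\<^sub>R x - real_pair k)) \<le> h x"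
        "(\<integral>\<^sup>+x. ennreal (h x) * indicator (cbox a b) x \<partial>lborel) \<le>
          ennreal (B * real q1 * real q2 / real n * (W * (8 * (snd b - snd a) + 12 * (fst b - fst a))))"
        using piecewise_monotone_L1_majorant[OF W(2,1) l t ab B cells n] by blast
      have [measurable]: "h \<in> borel_measurable borel" by (rule h)
      have "AE x in lebesgue. x \<in> cbox a b \<longrightarrow> \<bar>NN_op \<sigma> a b n f x - f x\<bar> \<le> h x / kappa\<^sup>2"
        using h(3)
      proof eventually_elim
        case (elim x)
        show ?case
        proof
          assume x: "x \<in> cbox a b"
          have "\<bar>NN_op \<sigma> a b n f x - f x\<bar> \<le> (\<Sum>k\<in>grid_idx a b n. \<bar>f (real_pair k /\<^sub>R real n) - f x\<bar> *
              Psi \<sigma> (real n *\<^sub>R x - real_pair k)) / kappa\<^sup>2"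
            by (rule NN_op_error_le[OF x n False])
          also have "\<dots> \<le> h x / kappa\<^sup>2" using elim x by (intro divide_right_mono) auto
          finally show "\<bar>NN_op \<sigma> a b n f x - f x\<bar> \<le> h x / kappa\<^sup>2" .
        qed
      qed
      moreover have "(\<integral>\<^sup>+x. ennreal (h x / kappa\<^sup>2) * indicator (cbox a b) x \<partial>lborel) \<le> ennreal D"
      proof -
        have "(\<integral>\<^sup>+x. ennreal (h x / kappa\<^sup>2) * indicator (cbox a b) x \<partial>lborel) =
            (\<integral>\<^sup>+x. ennreal (1 / kappa\<^sup>2) * (ennreal (h x) * indicator (cbox a b) x) \<partial>lborel)"
          by (intro nn_integral_cong) (simp add: ennreal_mult'[symmetric] indicator_def)
        also have "\<dots> = ennreal (1 / kappa\<^sup>2) * (\<integral>\<^sup>+x. ennreal (h x) * indicator (cbox a b) x \<partial>lborel)"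
          by (rule nn_integral_cmult) measurable
        also have "\<dots> \<le> ennreal (1 / kappa\<^sup>2) *
            ennreal (B * real q1 * real q2 / real n * (W * (8 * (snd b - snd a) + 12 * (fst b - fst a))))"
          by (intro mult_left_mono h(4)) auto
        also have "\<dots> = ennreal (B * real q1 * real q2 / real n * C1)"
          by (simp add: ennreal_mult'[symmetric] C1_def mult_ac)
        also have "\<dots> \<le> ennreal D"
          unfolding D_def C_def using B0 area N by (intro ennreal_leI mult_left_mono) auto
        finally show ?thesis .
      qed
      ultimately show ?thesis by (intro exI[of _ "\<lambda>x. h x / kappa\<^sup>2"]) auto
    qed
    then obtain h where h: "h \<in> borel_measurable borel"
        "AE x in lebesgue. x \<in> cbox a b \<longrightarrow> \<bar>NN_op \<sigma> a b n f x - f x\<bar> \<le> h x"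
        "(\<integral>\<^sup>+x. ennreal (h x) * indicator (cbox a b) x \<partial>lborel) \<le> ennreal D" by blast
    have "Lp_norm p (cbox a b) (\<lambda>x. NN_op \<sigma> a b n f x - f x) \<le> ((2 * B) powr (p - 1) * D) powr (1 / p)"
      using B0 by (intro Lp_norm_le_L1_majorant[OF p _ two_B h D0]) auto
    also have "(2 * B) powr (p - 1) * D = (2 powr (p - 1) * real q1 * real q2) * (B powr p * (C / real n))"
    proof -
      have "B powr p = B powr (p - 1) * B"
        using powr_add[of B "p - 1" 1] B0 by (cases "B = 0") simp_all
      thus ?thesis using B0 by (simp add: D_def powr_mult)
    qed
    also have "\<dots> powr (1 / p) = (2 powr (p - 1) * real q1 * real q2) powr (1 / p) *
        ((B powr p) powr (1 / p) * (C / real n) powr (1 / p))"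
      by (simp only: powr_mult)
    also have "(B powr p) powr (1 / p) = B" using B0 p by (simp add: powr_powr)
    finally show "Lp_norm p (cbox a b) (\<lambda>x. NN_op \<sigma> a b n f x - f x) \<le>
        (2 powr (p - 1) * real q1 * real q2) powr (1 / p) * (B * (C / real n) powr (1 / p))" .
  qed
qed

end

text \<open>Either \<open>C/x\<close> has already dropped below \<open>8/x\<^sup>\<theta>\<close>, or \<open>x\<^sup>1\<^sup>-\<^sup>\<theta> \<le> C/8\<close>. In the second case the decay
  factor \<open>1 / x powr (\<nu> * (1 - \<theta>) / p)\<close> is bounded below by a power of \<open>8/C\<close>, which the constant in front of it
  compensates.\<close>
lemma rate_comparison:
  fixes C p \<nu> \<theta> x :: real
  assumes C: "0 < C" and x: "1 \<le> x" and "1 \<le> p" "0 < \<nu>" "0 < \<theta>" "\<theta> < 1"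
  shows "(C / x) powr (1 / p) \<le>
    C powr (1 / p) * (C / 8) powr (\<nu> / p) / x powr (\<nu> * (1 - \<theta>) / p) + 8 powr (1 / p) / x powr (\<theta> / p)"
proof (cases "C / x \<le> 8 / x powr \<theta>")
  case True
  hence "(C / x) powr (1 / p) \<le> (8 / x powr \<theta>) powr (1 / p)"
    using assms by (intro powr_mono2) auto
  also have "\<dots> = 8 powr (1 / p) / x powr (\<theta> / p)"
    using x by (simp add: powr_divide powr_powr)
  finally show ?thesis by (simp add: add_increasing)
next
  case False
  have "x powr (1 - \<theta>) \<le> C / 8"
    using False x by (simp add: powr_diff field_simps)
  hence "(x powr (1 - \<theta>)) powr (\<nu> / p) \<le> (C / 8) powr (\<nu> / p)"
    using assms by (intro powr_mono2) auto
  hence *: "x powr (\<nu> * (1 - \<theta>) / p) \<le> (C / 8) powr (\<nu> / p)"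
    by (simp add: powr_powr mult.commute)
  have "C / x \<le> C / 1" using C x by (intro divide_left_mono) auto
  hence "(C / x) powr (1 / p) \<le> C powr (1 / p) * 1"
    using assms by (simp add: powr_mono2)
  also have "\<dots> \<le> C powr (1 / p) * ((C / 8) powr (\<nu> / p) / x powr (\<nu> * (1 - \<theta>) / p))"
    using * x by (intro mult_left_mono) (auto simp: le_divide_eq)
  finally show ?thesis by (simp add: add_increasing2)
qed

lemma interior_cell:
  "interior (cell q1 q2 l t i j) = {l i<..<l (Suc i)} \<times> {t j<..<t (Suc j)}"
  by (simp add: cell_def piece_def interior_Times)

text \<open>The lower bound keeps the partial derivatives away from zero and gives monotonicity; the upper
  bound makes \<open>f\<close> Lipschitz on the open cell and hence continuous.\<close>
lemma C1_nonzero_partials_imp_coordinatewise_monotone: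
  assumes p: "1 \<le> p" and \<beta>: "0 < \<beta>"
    and l: "subdivision (fst a) (fst b) q1 l" and t: "subdivision (snd a) (snd b) q2 t"
    and ij: "i < q1" "j < q2"
    and f: "C1_on (interior (cell q1 q2 l t i j)) f"
    and bnd: "\<And>x e. x \<in> interior (cell q1 q2 l t i j) \<Longrightarrow> e \<in> Basis \<Longrightarrow>
       \<bar>partial_deriv (cbox a b) f e x\<bar> powr p \<le> M \<and> \<beta> \<le> \<bar>partial_deriv (cbox a b) f e x\<bar> powr p"
  shows "coordinatewise_monotone_on {l i<..<l (Suc i)} {t j<..<t (Suc j)} f"
  unfolding coordinatewise_monotone_on_def
proof (intro conjI ballI)
  let ?A = "{l i<..<l (Suc i)}" and ?B = "{t j<..<t (Suc j)}"
  have f': "C1_on (?A \<times> ?B) f" using f by (simp add: interior_cell)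
  have "?A \<times> ?B \<subseteq> {fst a..fst b} \<times> {snd a..snd b}"
    by (intro Sigma_mono subdivision_piece_subset[OF l ij(1)] subdivision_piece_subset[OF t ij(2)])
  also have "\<dots> \<subseteq> cbox a b" by (auto simp: mem_cbox_real_pair)
  finally have sub: "?A \<times> ?B \<subseteq> cbox a b" .
  have bnd': "\<bar>partial_deriv (?A \<times> ?B) f e x\<bar> powr p \<le> M \<and> \<beta> \<le> \<bar>partial_deriv (?A \<times> ?B) f e x\<bar> powr p"
    if "x \<in> ?A \<times> ?B" "e \<in> Basis" for x e
    using bnd[of x e] partial_deriv_open_subset[of "?A \<times> ?B" "cbox a b" x f e] sub that
    by (simp add: interior_cell open_Times)
  have nz: "partial_deriv (?A \<times> ?B) f e x \<noteq> 0" if "x \<in> ?A \<times> ?B" "e \<in> Basis" for x e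
    using bnd'[OF that] \<beta> by auto
  show "mono_on ?A (\<lambda>s. f (s, v)) \<or> mono_on ?A (\<lambda>s. - f (s, v))" if v: "v \<in> ?B" for v
  proof (rule derivative_nonzero_imp_monotone)
    fix x assume x: "x \<in> ?A"
    have "{s. (s, v) \<in> ?A \<times> ?B} = ?A" using v by auto
    moreover have "at x within ?A = at x" using x by (intro at_within_open) auto
    ultimately show "((\<lambda>s. f (s, v)) has_real_derivative partial_deriv (?A \<times> ?B) f (1, 0) (x, v)) (at x)"
      using C1_on_has_partial_derivs(1)[OF f', of x v] x v by auto
    show "partial_deriv (?A \<times> ?B) f (1, 0) (x, v) \<noteq> 0"
      using x v by (intro nz) (auto simp: Basis_real_pair)
  qed
  show "mono_on ?B (\<lambda>s. f (u, s)) \<or> mono_on ?B (\<lambda>s. - f (u, s))" if u: "u \<in> ?A" for u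
  proof (rule derivative_nonzero_imp_monotone)
    fix x assume x: "x \<in> ?B"
    have "{s. (u, s) \<in> ?A \<times> ?B} = ?B" using u by auto
    moreover have "at x within ?B = at x" using x by (intro at_within_open) auto
    ultimately show "((\<lambda>s. f (u, s)) has_real_derivative partial_deriv (?A \<times> ?B) f (0, 1) (u, x)) (at x)"
      using C1_on_has_partial_derivs(2)[OF f', of u x] x u by auto
    show "partial_deriv (?A \<times> ?B) f (0, 1) (u, x) \<noteq> 0"
      using x u by (intro nz) (auto simp: Basis_real_pair)
  qed
  have "\<bar>partial_deriv (?A \<times> ?B) f e z\<bar> \<le> M powr (1 / p)" if "z \<in> ?A \<times> ?B" "e \<in> Basis" for z e
    using bnd'[OF that] p by (intro abs_le_powr_inverse) auto
  hence "\<bar>f z - f w\<bar> \<le> M powr (1 / p) * (\<bar>fst z - fst w\<bar> + \<bar>snd z - snd w\<bar>)"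
    if "z \<in> ?A \<times> ?B" "w \<in> ?A \<times> ?B" for z w
    using C1_on_rectangle_lipschitz[OF f', of "M powr (1 / p)" "fst z" "snd z" "fst w" "snd w"] that by auto
  thus "continuous_on (?A \<times> ?B) f" by (rule l1_lipschitz_continuous_on)
qed

theorem theorem6:
  fixes p \<alpha> \<nu> \<theta> :: real and \<sigma> :: "real \<Rightarrow> real" and a b :: "real \<times> real"
  assumes "1 \<le> p"
    and "mono \<sigma>" and "sigmoidal \<sigma>"
    and "\<forall>x. \<sigma> (- x) - 1/2 = - (\<sigma> x - 1/2)"
    and "\<forall>x. \<sigma> differentiable (at x)" and "\<forall>x. deriv \<sigma> differentiable (at x)"
    and "continuous_on UNIV (deriv (deriv \<sigma>))"
    and "concave_on {0..} \<sigma>"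
    and "\<alpha> > p" and "\<sigma> \<in> O[at_bot](\<lambda>x. \<bar>x\<bar> powr (- 1 - \<alpha>))"
    and "fst a < fst b" and "snd a < snd b"
    and "0 < \<nu>" and "\<nu> < \<alpha>" and "0 < \<theta>" and "\<theta> < 1"
  shows "(\<exists>K1>0. C1_estimate \<sigma> a b p K1) \<and>
    (\<exists>K2>0. \<forall>K1>0. C1_estimate \<sigma> a b p K1 \<longrightarrow>
      (\<forall>(q1::nat) (q2::nat) l t (f :: real \<times> real \<Rightarrow> real) M \<beta>.
        subdivision (fst a) (fst b) q1 l \<and> subdivision (snd a) (snd b) q2 t \<and>
        bounded (f ` cbox a b) \<and> 0 < M \<and> 0 < \<beta> \<and>
        (\<forall>i<q1. \<forall>j<q2. C1_on (interior (cell q1 q2 l t i j)) f \<and>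
          (\<forall>x\<in>interior (cell q1 q2 l t i j). \<forall>e\<in>Basis.
             \<bar>partial_deriv (cbox a b) f e x\<bar> powr p \<le> M \<and>
             \<beta> \<le> \<bar>partial_deriv (cbox a b) f e x\<bar> powr p)) \<longrightarrow>
        (\<forall>n::nat. 0 < n \<longrightarrow>
          Lp_norm p (cbox a b) (\<lambda>x. NN_op \<sigma> a b n f x - f x)
          \<le> (2 powr (p - 1) * real q1 * real q2) powr (1 / p) *
             ((M / \<beta>) powr (1 / p) * (K1 / real n) * W1p_norm p (cbox a b) f
              + K2 * sup_norm (cbox a b) f / real n powr (\<nu> * (1 - \<theta>) / p)
              + 8 powr (1 / p) * sup_norm (cbox a b) f / real n powr (\<theta> / p)))))"
proof -
  interpret decaying_sigmoid \<sigma> \<alpha>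
  proof
    show "\<sigma> (- x) = 1 - \<sigma> x" for x
      using \<open>\<forall>x. \<sigma> (- x) - 1/2 = - (\<sigma> x - 1/2)\<close>[rule_format, of x] by linarith
  qed (use assms in auto)
  obtain C where C: "0 < C" and
    rate: "\<And>q1 q2 l t (f :: real \<times> real \<Rightarrow> real) B (n::nat).
      subdivision (fst a) (fst b) q1 l \<Longrightarrow> subdivision (snd a) (snd b) q2 t \<Longrightarrow>
      (\<And>x. x \<in> cbox a b \<Longrightarrow> \<bar>f x\<bar> \<le> B) \<Longrightarrow>
      (\<And>i j. i < q1 \<Longrightarrow> j < q2 \<Longrightarrow>
         coordinatewise_monotone_on {l i<..<l (Suc i)} {t j<..<t (Suc j)} f) \<Longrightarrow>
      0 < n \<Longrightarrow>
      Lp_norm p (cbox a b) (\<lambda>x. NN_op \<sigma> a b n f x - f x) \<le>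
        (2 powr (p - 1) * real q1 * real q2) powr (1 / p) * (B * (C / real n) powr (1 / p))"
    using piecewise_monotone_rate[OF \<open>1 \<le> p\<close> \<open>fst a < fst b\<close> \<open>snd a < snd b\<close>] by blast
  define K2 where "K2 = C powr (1 / p) * (C / 8) powr (\<nu> / p)"
  have "0 < K2" using C by (simp add: K2_def)
  moreover have "Lp_norm p (cbox a b) (\<lambda>x. NN_op \<sigma> a b n f x - f x)
          \<le> (2 powr (p - 1) * real q1 * real q2) powr (1 / p) *
             ((M / \<beta>) powr (1 / p) * (K1 / real n) * W1p_norm p (cbox a b) f
              + K2 * sup_norm (cbox a b) f / real n powr (\<nu> * (1 - \<theta>) / p)
              + 8 powr (1 / p) * sup_norm (cbox a b) f / real n powr (\<theta> / p))"
    if K1: "0 < K1" and l: "subdivision (fst a) (fst b) q1 l" and t: "subdivision (snd a) (snd b) q2 t"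
      and bd: "bounded (f ` cbox a b)" and \<beta>: "0 < \<beta>"
      and cells: "\<forall>i<q1. \<forall>j<q2. C1_on (interior (cell q1 q2 l t i j)) f \<and>
          (\<forall>x\<in>interior (cell q1 q2 l t i j). \<forall>e\<in>Basis.
             \<bar>partial_deriv (cbox a b) f e x\<bar> powr p \<le> M \<and>
             \<beta> \<le> \<bar>partial_deriv (cbox a b) f e x\<bar> powr p)"
      and n: "0 < n"
    for K1 q1 q2 l t M \<beta> and f :: "real \<times> real \<Rightarrow> real" and n :: nat
  proof -
    let ?B = "sup_norm (cbox a b) f"
    obtain B0 where "\<forall>x\<in>cbox a b. \<bar>f x\<bar> \<le> B0"
      using bd by (auto simp: bounded_iff)
    hence bdd: "bdd_above ((\<lambda>x. \<bar>f x\<bar>) ` cbox a b)" by (intro bdd_aboveI2) auto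
    have B: "\<bar>f x\<bar> \<le> ?B" if "x \<in> cbox a b" for x
      unfolding sup_norm_def using that bdd by (intro cSUP_upper)
    have "a \<in> cbox a b" using assms by (simp add: mem_cbox_real_pair)
    hence B0: "0 \<le> ?B" using B by fastforce
    have regular: "coordinatewise_monotone_on {l i<..<l (Suc i)} {t j<..<t (Suc j)} f"
      if "i < q1" "j < q2" for i j
      using C1_nonzero_partials_imp_coordinatewise_monotone[OF \<open>1 \<le> p\<close> \<beta> l t that, of f M] cells that by blast
    have "Lp_norm p (cbox a b) (\<lambda>x. NN_op \<sigma> a b n f x - f x) \<le>
        (2 powr (p - 1) * real q1 * real q2) powr (1 / p) * (?B * (C / real n) powr (1 / p))"
      by (rule rate[OF l t B regular n])
    also have "\<dots> \<le> (2 powr (p - 1) * real q1 * real q2) powr (1 / p) *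
        ((M / \<beta>) powr (1 / p) * (K1 / real n) * W1p_norm p (cbox a b) f +
          ?B * (K2 / real n powr (\<nu> * (1 - \<theta>) / p) + 8 powr (1 / p) / real n powr (\<theta> / p)))"
    proof (rule mult_left_mono)
      have "(C / real n) powr (1 / p) \<le>
          K2 / real n powr (\<nu> * (1 - \<theta>) / p) + 8 powr (1 / p) / real n powr (\<theta> / p)"
        unfolding K2_def using rate_comparison[OF C, of "real n" p \<nu> \<theta>] assms n by simp
      hence "?B * (C / real n) powr (1 / p) \<le>
          ?B * (K2 / real n powr (\<nu> * (1 - \<theta>) / p) + 8 powr (1 / p) / real n powr (\<theta> / p))"
        using B0 by (intro mult_left_mono)
      moreover have "0 \<le> (M / \<beta>) powr (1 / p) * (K1 / real n) * W1p_norm p (cbox a b) f"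
        using K1 by (intro mult_nonneg_nonneg W1p_norm_nonneg) auto
      ultimately show "?B * (C / real n) powr (1 / p) \<le>
          (M / \<beta>) powr (1 / p) * (K1 / real n) * W1p_norm p (cbox a b) f +
          ?B * (K2 / real n powr (\<nu> * (1 - \<theta>) / p) + 8 powr (1 / p) / real n powr (\<theta> / p))"
        by linarith
    qed simp
    finally show ?thesis by (simp add: distrib_left mult.commute add.assoc)
  qed
  ultimately show ?thesis
    using C1_estimate_exists[OF \<open>1 \<le> p\<close> \<open>fst a < fst b\<close> \<open>snd a < snd b\<close>] by blast
qed

end
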